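(* Let $f$ be the germ at the origin of a real-analytic planar map, having an elliptic fixed point at the origin with rational rotation number $\omega_0=\frac{p}{q}\in(0,\tfrac12)$, $\gcd(p,q)=1$, $q\ge3$, and suppose $f$ admits a real-analytic first integral $I_1$, defined in a neighbourhood $U$ of the origin, with a non-degenerate local minimum at $(0,0)$. Suppose that $f$ admits a second real-analytic first integral $I_2$, functionally independent of $I_1$ in an open and dense subset of $U$. Then $f$ is real-analytically conjugate to its linear part.
   Context: A real-analytic planar map germ $f$ with $f(0,0)=(0,0)$ has an elliptic fixed point at the origin with rotation number $\omega_0\in(0,\tfrac12)$ if the eigenvalues of its linear part $L=d_{(0,0)}f$ are $\mu=e^{i2\pi\omega_0}$ and $\bar\mu$. The plane is identified with $\mathbb{C}$ via $z=x+iy$, and it is assumed that in this coordinate $L(z)=\mu z$. A first integral of $f$ is a function $I$ defined in a neighbourhood of the origin with $I\circ f=I$ near the origin. A non-degenerate local minimum at $(0,0)$ means a critical point there with positive definite Hessian. Functional independence of two functions on an open set means that their differentials are linearly independent at every point of it. Two germs $f,g$ fixing the origin are real-analytically conjugate if there is a germ of real-analytic diffeomorphism $\phi$ fixing the origin with $\phi^{-1}\circ f\circ\phi=g$. *)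

theory Defs
  imports "HOL-Analysis.Analysis"
begin

text \<open>
  The plane is the type \<open>complex\<close>, with real coordinates \<open>(Re z, Im z)\<close>; all derivatives are
  derivatives over the reals. A map germ at the origin is represented by a total function of which
  only the behaviour near \<open>0\<close> is ever constrained.
\<close>

(* Expansion as a power series in the two real coordinates; has_sum is unconditional summation. *)
definition real_analytic_at :: "(complex \<Rightarrow> 'b::real_normed_vector) \<Rightarrow> complex \<Rightarrow> bool" where
  "real_analytic_at f z \<longleftrightarrow>
     (\<exists>(a :: nat \<Rightarrow> nat \<Rightarrow> 'b) r. r > 0 \<and>
        (\<forall>w\<in>ball z r. ((\<lambda>(i, j). (Re (w - z) ^ i * Im (w - z) ^ j) *\<^sub>R a i j) has_sum f w) UNIV))"

definition real_analytic_on :: "(complex \<Rightarrow> 'b::real_normed_vector) \<Rightarrow> complex set \<Rightarrow> bool" where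
  "real_analytic_on f U \<longleftrightarrow> (\<forall>z\<in>U. real_analytic_at f z)"

definition linear_part :: "(complex \<Rightarrow> complex) \<Rightarrow> complex \<Rightarrow> complex" where
  "linear_part f = frechet_derivative f (at 0)"

definition matrix_of :: "(complex \<Rightarrow> complex) \<Rightarrow> complex ^ 2 ^ 2" where
  "matrix_of L = vector [vector [of_real (Re (L 1)), of_real (Re (L \<i>))],
                         vector [of_real (Im (L 1)), of_real (Im (L \<i>))]]"

(* The complex eigenvalues of a real-linear map of the plane, i.e. those of its real 2x2 matrix
   in the basis 1, \<i>. *)
definition eigenvalues :: "(complex \<Rightarrow> complex) \<Rightarrow> complex set" where
  "eigenvalues L = {c. \<exists>v. v \<noteq> 0 \<and> matrix_of L *v v = c *s v}"

definition elliptic_fixed_point :: "(complex \<Rightarrow> complex) \<Rightarrow> real \<Rightarrow> bool" where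
  "elliptic_fixed_point f \<omega> \<longleftrightarrow>
     0 < \<omega> \<and> \<omega> < 1 / 2 \<and> f 0 = 0 \<and> f differentiable at 0 \<and>
     eigenvalues (linear_part f) = {cis (2 * pi * \<omega>), cnj (cis (2 * pi * \<omega>))}"

(* The values of I outside U are irrelevant: near 0 both z and f z lie in U (f continuous at 0,
   f 0 = 0). *)
definition analytic_first_integral ::
    "(complex \<Rightarrow> complex) \<Rightarrow> complex set \<Rightarrow> (complex \<Rightarrow> real) \<Rightarrow> bool" where
  "analytic_first_integral f U I \<longleftrightarrow>
     real_analytic_on I U \<and> (\<forall>\<^sub>F z in nhds 0. I (f z) = I z)"

definition hessian :: "(complex \<Rightarrow> real) \<Rightarrow> complex \<Rightarrow> complex \<Rightarrow> complex \<Rightarrow> real" where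
  "hessian I z u v =
     frechet_derivative (\<lambda>w. frechet_derivative I (at w) u) (at z) v"

definition nondegenerate_local_min :: "(complex \<Rightarrow> real) \<Rightarrow> complex \<Rightarrow> bool" where
  "nondegenerate_local_min I z \<longleftrightarrow>
     (I has_derivative (\<lambda>_. 0)) (at z) \<and> (\<forall>v. v \<noteq> 0 \<longrightarrow> hessian I z v v > 0)"

definition functionally_independent_on ::
    "(complex \<Rightarrow> real) \<Rightarrow> (complex \<Rightarrow> real) \<Rightarrow> complex set \<Rightarrow> bool" where
  "functionally_independent_on I J V \<longleftrightarrow>
     (\<forall>z\<in>V. I differentiable at z \<and> J differentiable at z \<and>
        (\<forall>a b. (\<forall>v. a * frechet_derivative I (at z) v + b * frechet_derivative J (at z) v = 0)
           \<longrightarrow> a = 0 \<and> b = 0))"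

definition analytic_diffeo_germ :: "(complex \<Rightarrow> complex) \<Rightarrow> (complex \<Rightarrow> complex) \<Rightarrow> bool" where
  "analytic_diffeo_germ \<phi> \<psi> \<longleftrightarrow>
     real_analytic_at \<phi> 0 \<and> real_analytic_at \<psi> 0 \<and> \<phi> 0 = 0 \<and> \<psi> 0 = 0 \<and>
     (\<forall>\<^sub>F z in nhds 0. \<psi> (\<phi> z) = z) \<and> (\<forall>\<^sub>F z in nhds 0. \<phi> (\<psi> z) = z)"

(* \<psi> is the inverse germ of \<phi>. *)
definition analytically_conjugate :: "(complex \<Rightarrow> complex) \<Rightarrow> (complex \<Rightarrow> complex) \<Rightarrow> bool" where
  "analytically_conjugate f g \<longleftrightarrow>
     (\<exists>\<phi> \<psi>. analytic_diffeo_germ \<phi> \<psi> \<and> (\<forall>\<^sub>F z in nhds 0. \<psi> (f (\<phi> z)) = g z))"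

end

theory Submission
  imports Defs "HOL-Complex_Analysis.Cauchy_Integral_Formula"
begin

text \<open>
  The iterate \<open>g = f ^^ q\<close> is tangent to the identity and has the same first integrals as \<open>f\<close>. If
  \<open>g\<close> were not the identity, let \<open>H\<close> be the leading form of \<open>g - id\<close>, of degree at least 2. Comparing
  lowest order terms in \<open>I (g z) = I z\<close> shows that the differential of the leading form of any first
  integral annihilates \<open>H z\<close>. The quadratic part of \<open>I\<^sub>1 - I\<^sub>1 0\<close> is invariant under the rotation
  by \<open>\<mu>\<close>, where \<open>\<mu>\<^sup>2 \<noteq> 1\<close>, so it is a nonzero multiple of \<open>|z|\<^sup>2\<close>; hence \<open>H\<close> is tangent to the circles
  around \<open>0\<close>, and leading forms of first integrals are multiples of even powers of \<open>|z|\<close>. Subtracting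
  powers of \<open>I\<^sub>1 - I\<^sub>1 0\<close> one after the other, \<open>I\<^sub>2\<close> agrees to every order with a polynomial in
  \<open>I\<^sub>1 - I\<^sub>1 0\<close>, so the analytic function \<open>dI\<^sub>1 \<and> dI\<^sub>2\<close> is flat at \<open>0\<close> and vanishes near \<open>0\<close>, which
  contradicts functional independence. So \<open>f ^^ q = id\<close> near \<open>0\<close>, and the average
  \<open>\<psi> = (\<Sum>j<q. f ^^ j / \<mu> ^ j) / q\<close> satisfies \<open>\<psi> \<circ> f = \<mu> \<psi>\<close>.

  Closure of real-analytic germs under composition and local inversion is obtained by extending them to
  complex differentiable functions on a neighbourhood of \<open>0\<close> in \<open>\<complex> \<times> \<complex>\<close>.
\<close>

subsection \<open>Double power series\<close>

text \<open>The delicate step is the comparison of lowest order terms. If a first integral has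
  leading form J of degree m and g - id has leading form H of degree k, the derivative of J along H
  lives in degree m + k - 1. Bounding the remainder after J separately at g z and at z gives only
  order m + 1, which is too weak for each k >= 2. The remainder has to be estimated on the
  difference, through a Lipschitz constant of order m (\<open>real_analytic_lipschitz\<close>); this
  yields order m + k. The polynomials approximating the second integral may change with the order,
  and no limit of them is formed. The Jacobian does not see them, because dK wedge d(P(K)) = 0, and
  one fixed analytic function that is flat must vanish. Inverting \<psi> in C x C raises a question
  of its own: the inverse has to preserve the real plane. This follows from invariance under complex
  conjugation.\<close>

definition psum :: "(nat \<times> nat \<Rightarrow> complex) \<Rightarrow> complex \<times> complex \<Rightarrow> complex" where
  "psum c p = (\<Sum>\<^sub>\<infinity>k. c k * fst p ^ fst k * snd p ^ snd k)"

text \<open>Absolute convergence at the corner (r, r). Each term on the closed bidisc of radius r is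
  dominated by the corresponding term there, so one numerical series controls convergence
  throughout.\<close>

definition majorized :: "(nat \<times> nat \<Rightarrow> complex) \<Rightarrow> real \<Rightarrow> bool" where
  "majorized c r \<longleftrightarrow> (\<lambda>k. norm (c k) * r ^ (fst k + snd k)) summable_on UNIV"

lemma norm_monomial_le:
  fixes z w :: complex
  assumes "norm z \<le> r" "norm w \<le> r"
  shows "norm (z ^ i * w ^ j) \<le> r ^ (i + j)"
  using assms order_trans[OF norm_ge_zero assms(1)]
  by (simp add: norm_mult norm_power power_add mult_mono power_mono)

lemma majorized_term_le:
  assumes "norm (fst p) \<le> r" "norm (snd p) \<le> r"
  shows "norm (c k * fst p ^ fst k * snd p ^ snd k) \<le> norm (c k :: complex) * r ^ (fst k + snd k)"
  using norm_monomial_le[OF assms, of "fst k" "snd k"]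
  by (simp add: norm_mult mult.assoc mult_left_mono)

lemma majorized_abs_summable:
  assumes "majorized c r" "norm (fst p) \<le> r" "norm (snd p) \<le> r"
  shows "(\<lambda>k. norm (c k * fst p ^ fst k * snd p ^ snd k)) summable_on UNIV"
  by (rule summable_on_comparison_test[OF assms(1)[unfolded majorized_def]])
     (rule majorized_term_le[OF assms(2,3)], rule norm_ge_zero)

lemma majorized_has_sum:
  assumes "majorized c r" "norm (fst p) \<le> r" "norm (snd p) \<le> r"
  shows "((\<lambda>k. c k * fst p ^ fst k * snd p ^ snd k) has_sum psum c p) UNIV"
  unfolding psum_def
  using abs_summable_summable[OF majorized_abs_summable[OF assms]] by auto

lemma majorized_mono:
  assumes "majorized c R" "0 \<le> r" "r \<le> R"
  shows "majorized c r"
  unfolding majorized_def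
  by (rule summable_on_comparison_test[OF assms(1)[unfolded majorized_def]])
     (use assms in \<open>simp_all add: mult_left_mono power_mono\<close>)

text \<open>Since n (r / R) ^ n tends to 0, the factor n produced by differentiation is absorbed by
  enlarging the radius. This is why differentiated series are controlled on strictly smaller bidiscs
  below.\<close>

lemma nat_times_power_bounded:
  fixes r R :: real
  assumes "0 < r" "r < R"
  obtains B where "0 < B" "\<And>n. real n * r ^ (n - 1) \<le> B * R ^ n"
proof -
  have "(\<lambda>n. real n * (r / R) ^ n) \<longlonglongrightarrow> 0"
    by (rule powser_times_n_limit_0) (use assms in simp)
  then have "Bseq (\<lambda>n. real n * (r / R) ^ n)"
    by (rule convergent_imp_Bseq[OF convergentI])
  then obtain B where B: "B > 0" "\<And>n. norm (real n * (r / R) ^ n) \<le> B"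
    by (rule BseqE) blast
  have "real n * r ^ (n - 1) \<le> (B / r) * R ^ n" for n
  proof (cases n)
    case (Suc m)
    have "real n * (r / R) ^ n \<le> B" using B(2)[of n] by simp
    then have "real n * r ^ n \<le> B * R ^ n" using assms by (simp add: power_divide field_simps)
    then show ?thesis using assms Suc by (simp add: field_simps)
  qed (use assms B in auto)
  then show ?thesis using that[of "B / r"] B assms by auto
qed

text \<open>One numerical series dominates both partial derivatives termwise; it bounds the shifted
  coefficients and is the Weierstrass majorant in \<open>psum_has_derivative\<close>.\<close>

lemma majorized_degree_weighted:
  assumes "majorized c R" "0 < r" "r < R"
  shows "(\<lambda>k. norm (c k) * (real (fst k + snd k) * r ^ (fst k + snd k - 1))) summable_on UNIV"
proof -
  obtain B where B: "0 < B" "\<And>n. real n * r ^ (n - 1) \<le> B * R ^ n"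
    using nat_times_power_bounded assms by metis
  have "(\<lambda>k. B * (norm (c k) * R ^ (fst k + snd k))) summable_on UNIV"
    using assms(1) unfolding majorized_def by (intro summable_on_cmult_right)
  then show ?thesis
  proof (rule summable_on_comparison_test)
    fix k :: "nat \<times> nat"
    show "norm (c k) * (real (fst k + snd k) * r ^ (fst k + snd k - 1)) \<le> B * (norm (c k) * R ^ (fst k + snd k))"
      using mult_left_mono[OF B(2)[of "fst k + snd k"], of "norm (c k)"] by (simp add: mult_ac)
  qed (use assms in auto)
qed

definition dx_coeff :: "(nat \<times> nat \<Rightarrow> complex) \<Rightarrow> nat \<times> nat \<Rightarrow> complex" where
  "dx_coeff c = (\<lambda>(i, j). of_nat (Suc i) * c (Suc i, j))"

definition dy_coeff :: "(nat \<times> nat \<Rightarrow> complex) \<Rightarrow> nat \<times> nat \<Rightarrow> complex" where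
  "dy_coeff c = (\<lambda>(i, j). of_nat (Suc j) * c (i, Suc j))"

lemma majorized_dx:
  assumes "majorized c R" "0 < r" "r < R"
  shows "majorized (dx_coeff c) r"
proof -
  let ?g = "\<lambda>k. norm (c k) * (real (fst k + snd k) * r ^ (fst k + snd k - 1))"
  let ?s = "\<lambda>k::nat\<times>nat. (Suc (fst k), snd k)"
  have "inj ?s" by (auto simp: inj_on_def)
  moreover have "?g summable_on range ?s"
    by (rule summable_on_subset[OF majorized_degree_weighted[OF assms]]) auto
  ultimately have "(?g \<circ> ?s) summable_on UNIV" using summable_on_reindex by blast
  then show ?thesis unfolding majorized_def
  proof (rule summable_on_comparison_test)
    fix k :: "nat \<times> nat"
    obtain i j where k: "k = (i, j)" by force
    have "real (Suc i) * (norm (c (Suc i, j)) * r ^ (i + j)) \<le> (real i + real j + 1) * (norm (c (Suc i, j)) * r ^ (i + j))"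
      by (rule mult_right_mono) (use assms in auto)
    then show "norm (dx_coeff c k) * r ^ (fst k + snd k) \<le> (?g \<circ> ?s) k"
      by (simp add: k dx_coeff_def norm_mult algebra_simps del: of_nat_Suc)
         (simp add: algebra_simps)
  qed (use assms in simp)
qed

lemma majorized_dy:
  assumes "majorized c R" "0 < r" "r < R"
  shows "majorized (dy_coeff c) r"
proof -
  let ?g = "\<lambda>k. norm (c k) * (real (fst k + snd k) * r ^ (fst k + snd k - 1))"
  let ?s = "\<lambda>k::nat\<times>nat. (fst k, Suc (snd k))"
  have "inj ?s" by (auto simp: inj_on_def)
  moreover have "?g summable_on range ?s"
    by (rule summable_on_subset[OF majorized_degree_weighted[OF assms]]) auto
  ultimately have "(?g \<circ> ?s) summable_on UNIV" using summable_on_reindex by blast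
  then show ?thesis unfolding majorized_def
  proof (rule summable_on_comparison_test)
    fix k :: "nat \<times> nat"
    obtain i j where k: "k = (i, j)" by force
    have "real (Suc j) * (norm (c (i, Suc j)) * r ^ (i + j)) \<le> (real i + real j + 1) * (norm (c (i, Suc j)) * r ^ (i + j))"
      by (rule mult_right_mono) (use assms in auto)
    then show "norm (dy_coeff c k) * r ^ (fst k + snd k) \<le> (?g \<circ> ?s) k"
      by (simp add: k dy_coeff_def norm_mult algebra_simps del: of_nat_Suc)
         (simp add: algebra_simps)
  qed (use assms in simp)
qed

text \<open>Raising an exponent by one embeds the index set properly into itself; the indices
  outside the image belong to terms that differentiation kills.\<close>

lemma has_sum_extend_by_zero:
  fixes g :: "'b \<Rightarrow> 'c::{comm_monoid_add, topological_space}"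
  assumes "inj s" "((g \<circ> s) has_sum S) UNIV" "\<And>k. k \<notin> range s \<Longrightarrow> g k = 0"
  shows "(g has_sum S) UNIV"
proof -
  have "(g has_sum S) (range s)" using has_sum_reindex[OF assms(1), of g] assms(2) by blast
  moreover have "(g has_sum S) (range s) \<longleftrightarrow> (g has_sum S) UNIV"
    by (rule has_sum_cong_neutral) (use assms(3) in auto)
  ultimately show ?thesis by blast
qed

text \<open>The terms stay indexed as in the undifferentiated series, as termwise differentiation
  requires. The truncated subtraction in \<open>fst k - 1\<close> is harmless because the factor
  \<open>of_nat (fst k)\<close> vanishes there.\<close>

lemma has_sum_dx:
  assumes "majorized (dx_coeff c) r" "norm (fst p) \<le> r" "norm (snd p) \<le> r"
  shows "((\<lambda>k. c k * (of_nat (fst k) * fst p ^ (fst k - 1)) * snd p ^ snd k) has_sum psum (dx_coeff c) p) UNIV"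
    (is "(?g has_sum _) _")
proof -
  let ?s = "\<lambda>k::nat\<times>nat. (Suc (fst k), snd k)"
  have "inj ?s" by (auto simp: inj_on_def)
  moreover have "((?g \<circ> ?s) has_sum psum (dx_coeff c) p) UNIV"
    by (rule has_sum_cong[THEN iffD1, OF _ majorized_has_sum[OF assms]])
       (auto simp: dx_coeff_def mult_ac simp del: of_nat_Suc split: prod.split)
  moreover have "?g k = 0" if "k \<notin> range ?s" for k
  proof -
    have "fst k = 0"
      using that not0_implies_Suc[of "fst k"] by (cases k) (force simp: image_iff)
    then show ?thesis by simp
  qed
  ultimately show ?thesis by (rule has_sum_extend_by_zero)
qed

lemma has_sum_dy:
  assumes "majorized (dy_coeff c) r" "norm (fst p) \<le> r" "norm (snd p) \<le> r"
  shows "((\<lambda>k. c k * fst p ^ fst k * (of_nat (snd k) * snd p ^ (snd k - 1))) has_sum psum (dy_coeff c) p) UNIV"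
    (is "(?g has_sum _) _")
proof -
  let ?s = "\<lambda>k::nat\<times>nat. (fst k, Suc (snd k))"
  have "inj ?s" by (auto simp: inj_on_def)
  moreover have "((?g \<circ> ?s) has_sum psum (dy_coeff c) p) UNIV"
    by (rule has_sum_cong[THEN iffD1, OF _ majorized_has_sum[OF assms]])
       (auto simp: dy_coeff_def mult_ac simp del: of_nat_Suc split: prod.split)
  moreover have "?g k = 0" if "k \<notin> range ?s" for k
  proof -
    have "snd k = 0"
      using that not0_implies_Suc[of "snd k"] by (cases k) (force simp: image_iff)
    then show ?thesis by simp
  qed
  ultimately show ?thesis by (rule has_sum_extend_by_zero)
qed

lemma has_sum_imp_sums_prod_decode:
  assumes "(f has_sum s) (UNIV :: (nat \<times> nat) set)"
  shows "(\<lambda>n. f (prod_decode n)) sums s"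
  using has_sum_reindex_bij_betw[OF bij_prod_decode, of f s] assms has_sum_imp_sums by blast

lemma psum_has_derivative:
  assumes c: "majorized c R" and r: "0 < r" "r < R" and p: "p \<in> ball 0 r \<times> ball 0 r"
  shows "(psum c has_derivative (\<lambda>h. psum (dx_coeff c) p * fst h + psum (dy_coeff c) p * snd h)) (at p)"
proof -
  let ?S = "ball 0 r \<times> ball 0 r :: (complex \<times> complex) set"
  let ?d = "prod_decode"
  \<comment> \<open>The theorem on differentiating series speaks of sequences, so the exponent pairs
    are enumerated by \<open>prod_decode\<close>; absolute convergence makes the order
    immaterial.\<close>
  define f where "f n p = c (?d n) * fst p ^ fst (?d n) * snd p ^ snd (?d n)" for n and p :: "complex \<times> complex"
  define f' where "f' n p h = c (?d n) * (of_nat (fst (?d n)) * fst p ^ (fst (?d n) - 1)) * snd p ^ snd (?d n) * fst h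
      + c (?d n) * fst p ^ fst (?d n) * (of_nat (snd (?d n)) * snd p ^ (snd (?d n) - 1)) * snd h"
    for n and p h :: "complex \<times> complex"
  let ?g' = "\<lambda>p h. psum (dx_coeff c) p * fst h + psum (dy_coeff c) p * snd h"
  let ?M = "\<lambda>n. norm (c (?d n)) * (real (fst (?d n) + snd (?d n)) * r ^ (fst (?d n) + snd (?d n) - 1))"
  have M: "summable ?M"
    using summable_on_reindex_bij_betw[OF bij_prod_decode,
        of "\<lambda>k. norm (c k) * (real (fst k + snd k) * r ^ (fst k + snd k - 1))"]
      majorized_degree_weighted[OF c r] summable_on_imp_summable by blast
  have der: "(f n has_derivative f' n x) (at x within ?S)" for n x
    unfolding f_def[abs_def] f'_def[abs_def]
    by (auto intro!: derivative_eq_intros simp: algebra_simps)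
  have f_sums: "(\<lambda>n. f n x) sums psum c x" if "x \<in> ?S" for x
    unfolding f_def
    by (rule has_sum_imp_sums_prod_decode[OF majorized_has_sum[OF c]]) (use that r in auto)
  have f'_sums: "(\<lambda>n. f' n x h) sums ?g' x h" if "x \<in> ?S" for x h
    unfolding f'_def
    by (intro sums_add sums_mult2
        has_sum_imp_sums_prod_decode[OF has_sum_dx[OF majorized_dx[OF c r]]]
        has_sum_imp_sums_prod_decode[OF has_sum_dy[OF majorized_dy[OF c r]]])
       (use that in auto)
  \<comment> \<open>The bound does not involve x beyond membership in \<open>?S\<close>: the tails
    of \<open>?M\<close> then give uniform convergence of the derivatives.\<close>
  have f'_le: "norm (f' n x h) \<le> ?M n * norm h" if "x \<in> ?S" for n x h
  proof -
    obtain i j where ij: "?d n = (i, j)" by force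
    have x: "norm (fst x) \<le> r" "norm (snd x) \<le> r" using that by auto
    have 1: "real i * norm (fst x ^ (i - 1) * snd x ^ j) \<le> real i * r ^ (i + j - 1)"
    proof (cases i)
      case (Suc m) then show ?thesis using norm_monomial_le[OF x, of m j] by (simp add: mult_left_mono)
    qed auto
    have 2: "real j * norm (fst x ^ i * snd x ^ (j - 1)) \<le> real j * r ^ (i + j - 1)"
    proof (cases j)
      case (Suc m) then show ?thesis using norm_monomial_le[OF x, of i m] by (simp add: mult_left_mono)
    qed auto
    have h: "norm (fst h) \<le> norm h" "norm (snd h) \<le> norm h"
      by (metis norm_fst_le prod.collapse, metis norm_snd_le prod.collapse)
    have "norm (f' n x h) \<le> norm (c (i,j)) * (real i * norm (fst x ^ (i - 1) * snd x ^ j) * norm (fst h)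
         + real j * norm (fst x ^ i * snd x ^ (j - 1)) * norm (snd h))"
      unfolding f'_def ij
      by (rule order_trans[OF norm_triangle_ineq]) (simp add: norm_mult algebra_simps)
    also have "\<dots> \<le> norm (c (i,j)) * (real i * r ^ (i + j - 1) * norm h + real j * r ^ (i + j - 1) * norm h)"
      by (intro mult_left_mono add_mono mult_mono 1 2 h) (use r in auto)
    finally show ?thesis by (simp add: ij algebra_simps)
  qed
  have "\<exists>g. \<forall>x\<in>?S. (\<lambda>n. f n x) sums (g x) \<and> (g has_derivative ?g' x) (at x within ?S)"
  proof (rule has_derivative_series[where f' = f'])
    show "convex ?S" by (intro convex_Times convex_ball)
    fix e :: real assume "e > 0"
    then obtain N where N: "\<And>n. n \<ge> N \<Longrightarrow> norm (\<Sum>i. ?M (i + n)) < e"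
      using suminf_exist_split[OF \<open>e > 0\<close> M] by blast
    have "norm ((\<Sum>i<n. f' i x h) - ?g' x h) \<le> e * norm h" if "n \<ge> N" "x \<in> ?S" for n x h
    proof -
      have "?g' x h = (\<Sum>i. f' (i + n) x h) + (\<Sum>i<n. f' i x h)"
        using suminf_split_initial_segment[OF sums_summable[OF f'_sums[OF that(2), of h]], of n]
          sums_unique[OF f'_sums[OF that(2), of h]] by simp
      then have "norm ((\<Sum>i<n. f' i x h) - ?g' x h) = norm (\<Sum>i. f' (i + n) x h)"
        by (simp add: norm_minus_commute)
      also have "\<dots> \<le> (\<Sum>i. ?M (i + n) * norm h)"
      proof (rule norm_suminf_le)
        show "summable (\<lambda>i. ?M (i + n) * norm h)"
          using summable_mult2[OF summable_ignore_initial_segment[OF M]] by blast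
      qed (rule f'_le[OF that(2)])
      also have "\<dots> = (\<Sum>i. ?M (i + n)) * norm h"
        by (rule suminf_mult2[symmetric, OF summable_ignore_initial_segment[OF M]])
      also have "\<dots> \<le> e * norm h"
        using N[OF that(1)] by (intro mult_right_mono) auto
      finally show ?thesis .
    qed
    then show "\<forall>\<^sub>F n in sequentially. \<forall>x\<in>?S. \<forall>h. norm ((\<Sum>i<n. f' i x h) - ?g' x h) \<le> e * norm h"
      unfolding eventually_sequentially by blast
  qed (rule der p f_sums[OF p])+
  then obtain g where g: "\<And>x. x \<in> ?S \<Longrightarrow> (\<lambda>n. f n x) sums (g x)"
      "\<And>x. x \<in> ?S \<Longrightarrow> (g has_derivative ?g' x) (at x within ?S)" by blast
  have g_eq: "g x = psum c x" if "x \<in> ?S" for x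
    using sums_unique2[OF g(1) f_sums] that by blast
  have "(psum c has_derivative ?g' p) (at p within ?S)"
    by (rule has_derivative_transform[OF p g_eq[symmetric] g(2)[OF p]])
  moreover have "open ?S" by (intro open_Times) auto
  ultimately show ?thesis using at_within_open[OF p] by simp
qed

subsection \<open>Holomorphic functions of two variables\<close>

text \<open>The derivative is complex linear in h, so the function is holomorphic in each variable.
  Continuity of both partial derivatives is built in because differentiation under Cauchy's integral
  relies on it.\<close>

definition hol2 :: "(complex \<times> complex \<Rightarrow> complex) \<Rightarrow> (complex \<times> complex) set \<Rightarrow> bool" where
  "hol2 F S \<longleftrightarrow> (\<exists>A B. continuous_on S A \<and> continuous_on S B \<and>
     (\<forall>p\<in>S. (F has_derivative (\<lambda>h. A p * fst h + B p * snd h)) (at p)))"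

lemma hol2_subset: "hol2 F S \<Longrightarrow> T \<subseteq> S \<Longrightarrow> hol2 F T"
  unfolding hol2_def by (meson continuous_on_subset subsetD)

lemma hol2_continuous_on: "hol2 F S \<Longrightarrow> continuous_on S F"
  unfolding hol2_def
  by (meson continuous_at_imp_continuous_on has_derivative_continuous)

lemma psum_continuous_on:
  assumes "majorized c R" "0 < r" "r < R"
  shows "continuous_on (ball 0 r \<times> ball 0 r) (psum c)"
  using psum_has_derivative[OF assms]
  by (meson continuous_at_imp_continuous_on has_derivative_continuous)

text \<open>The intermediate radius leaves room twice: from R to \<open>r'\<close> for the
  differentiated series to be majorized, and from \<open>r'\<close> to r for their sums to be
  continuous.\<close>

lemma hol2_psum:
  assumes "majorized c R" "0 < r" "r < R"
  shows "hol2 (psum c) (ball 0 r \<times> ball 0 r)"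
proof -
  obtain r' where r': "r < r'" "r' < R" using dense assms(3) by blast
  then show ?thesis unfolding hol2_def
    using psum_has_derivative[OF assms] assms
      psum_continuous_on[OF majorized_dx[of c R r'], of r]
      psum_continuous_on[OF majorized_dy[of c R r'], of r] by auto
qed

section \<open>Taylor expansion of holomorphic functions of two variables\<close>

lemma majorized_geometric:
  assumes "\<And>i j. norm (c (i, j)) \<le> M / \<rho> ^ (i + j)" "0 < r" "r < \<rho>"
  shows "majorized c r"
proof -
  define x where "x = r / \<rho>"
  have x: "0 \<le> x" "x < 1" using assms by (auto simp: x_def)
  have M: "0 \<le> M" using order_trans[OF norm_ge_zero assms(1)[of 0 0]] by simp
  have g: "((\<lambda>j. x ^ j) has_sum (1 / (1 - x))) UNIV"
    by (rule sums_nonneg_imp_has_sum) (use x in \<open>auto intro!: geometric_sums\<close>)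
  have "(\<lambda>k. x ^ fst k * x ^ snd k) summable_on (SIGMA i:UNIV. UNIV)"
  proof (rule summable_on_SigmaI)
    show "((\<lambda>y. x ^ fst (i, y) * x ^ snd (i, y)) has_sum (x ^ i * (1 / (1 - x)))) UNIV" for i :: nat
      using has_sum_cmult_right[OF g, of "x ^ i"] by simp
    show "(\<lambda>i. x ^ i * (1 / (1 - x))) summable_on UNIV"
      using has_sum_cmult_left[OF g, of "1 / (1 - x)"] by (rule has_sum_imp_summable)
  qed (use x in auto)
  then have "(\<lambda>k. M * (x ^ fst k * x ^ snd k)) summable_on UNIV"
    by (intro summable_on_cmult_right) simp
  then show ?thesis unfolding majorized_def
  proof (rule summable_on_comparison_test)
    fix k :: "nat \<times> nat"
    have "norm (c k) * r ^ (fst k + snd k) \<le> M / \<rho> ^ (fst k + snd k) * r ^ (fst k + snd k)"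
      using assms(1)[of "fst k" "snd k"] assms(2) by (intro mult_right_mono) auto
    also have "\<dots> = M * (x ^ fst k * x ^ snd k)"
      by (simp add: x_def power_divide power_add)
    finally show "norm (c k) * r ^ (fst k + snd k) \<le> M * (x ^ fst k * x ^ snd k)" .
  qed (use assms in simp)
qed

lemma hol2_slices:
  assumes "hol2 F S" and S: "X \<times> Y \<subseteq> S"
  shows "y \<in> Y \<Longrightarrow> (\<lambda>z. F (z, y)) holomorphic_on X" "x \<in> X \<Longrightarrow> (\<lambda>w. F (x, w)) holomorphic_on Y"
proof -
  obtain A B where AB: "\<And>p. p \<in> S \<Longrightarrow> (F has_derivative (\<lambda>h. A p * fst h + B p * snd h)) (at p)"
    using assms(1) unfolding hol2_def by blast
  have "((\<lambda>z. F (z, y)) has_field_derivative A (x, y)) (at x)"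
       "((\<lambda>w. F (x, w)) has_field_derivative B (x, y)) (at y)" if "(x, y) \<in> S" for x y
  proof -
    have "((\<lambda>z. (z, y)) has_derivative (\<lambda>h. (h, 0))) (at x)" "((\<lambda>w. (x, w)) has_derivative (\<lambda>h. (0, h))) (at y)"
      by (auto intro!: derivative_eq_intros)
    then show "((\<lambda>z. F (z, y)) has_field_derivative A (x, y)) (at x)"
         "((\<lambda>w. F (x, w)) has_field_derivative B (x, y)) (at y)"
      using has_derivative_compose[where f = "\<lambda>z. (z, y)" and g = F, OF _ AB[OF that]]
        has_derivative_compose[where f = "\<lambda>w. (x, w)" and g = F, OF _ AB[OF that]]
      by (force simp: has_field_derivative_def)+
  qed
  then show "y \<in> Y \<Longrightarrow> (\<lambda>z. F (z, y)) holomorphic_on X" "x \<in> X \<Longrightarrow> (\<lambda>w. F (x, w)) holomorphic_on Y"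
    using S unfolding holomorphic_on_def field_differentiable_def
    by (meson has_field_derivative_at_within mem_Sigma_iff subsetD)+
qed

text \<open>Differentiating Cauchy's integral under the integral sign makes the Taylor coefficients in the
  first variable holomorphic in the second.\<close>

lemma hol2_deriv_holomorphic:
  assumes F: "hol2 F S" and sub: "cball 0 \<rho> \<times> cball 0 \<rho> \<subseteq> S" and "0 < \<rho>"
  shows "(\<lambda>w. (deriv ^^ i) (\<lambda>z. F (z, w)) 0) holomorphic_on cball 0 \<rho>"
proof -
  obtain A B where B: "continuous_on S B"
    and AB: "\<And>p. p \<in> S \<Longrightarrow> (F has_derivative (\<lambda>h. A p * fst h + B p * snd h)) (at p)"
    using F unfolding hol2_def by blast
  let ?\<gamma> = "circlepath 0 \<rho>"
  \<comment> \<open>The velocity of the circle divided by u ^ (i + 1): Cauchy's formula becomes an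
    integral over \<open>{0..1}\<close> with a weight free of w.\<close>
  let ?m = "\<lambda>t::real. 2 * pi * \<i> * \<rho> * exp (2 * of_real pi * \<i> * t) / ?\<gamma> t ^ Suc i"
  have \<gamma>: "?\<gamma> t \<in> cball 0 \<rho>" "?\<gamma> t \<noteq> 0" for t
    using \<open>0 < \<rho>\<close> by (auto simp: circlepath norm_mult)
  have cont\<gamma>: "continuous_on X ?\<gamma>" for X
    unfolding circlepath by (intro continuous_intros)
  have contm: "continuous_on X ?m" for X
    using \<gamma>(2) by (intro continuous_intros cont\<gamma>) auto
  have slice: "continuous_on (cball 0 \<rho>) (\<lambda>z. F (z, w))" "(\<lambda>z. F (z, w)) holomorphic_on ball 0 \<rho>"
    if "w \<in> cball 0 \<rho>" for w
    using holomorphic_on_imp_continuous_on[OF hol2_slices(1)[OF F sub that]]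
      holomorphic_on_subset[OF hol2_slices(1)[OF F sub that] ball_subset_cball] by auto
  have eq: "(deriv ^^ i) (\<lambda>z. F (z, w)) 0
      = fact i / (2 * pi * \<i>) * integral {0..1} (\<lambda>t. F (?\<gamma> t, w) * ?m t)" if w: "w \<in> cball 0 \<rho>" for w
  proof -
    have "(deriv ^^ i) (\<lambda>z. F (z, w)) 0
      = fact i / (2 * pi * \<i>) * contour_integral ?\<gamma> (\<lambda>u. F (u, w) / u ^ Suc i)"
      using Cauchy_higher_derivative_integral_circlepath(2)[OF slice[OF w], of 0 i] \<open>0 < \<rho>\<close> by simp
    also have "contour_integral ?\<gamma> (\<lambda>u. F (u, w) / u ^ Suc i) = integral {0..1} (\<lambda>t. F (?\<gamma> t, w) * ?m t)"
      unfolding contour_integral_integral vector_derivative_circlepath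
      by (simp add: mult_ac)
    finally show ?thesis .
  qed
  have "(\<lambda>w. integral (cbox 0 1) (\<lambda>t. F (?\<gamma> t, w) * ?m t)) holomorphic_on cball 0 \<rho>"
  proof (rule leibniz_rule_holomorphic[where fx = "\<lambda>w t. B (?\<gamma> t, w) * ?m t"])
    show "convex (cball 0 \<rho> :: complex set)" by simp
  next
    fix w :: complex and t :: real assume w: "w \<in> cball 0 \<rho>"
    have in_S: "(?\<gamma> t, w) \<in> S" using w \<gamma>(1)[of t] by (intro subsetD[OF sub]) auto
    have "((\<lambda>w. (?\<gamma> t, w)) has_derivative (\<lambda>h. (0, h))) (at w)"
      by (auto intro!: derivative_eq_intros)
    from has_derivative_compose[where f = "\<lambda>w. (?\<gamma> t, w)" and g = F, OF this AB[OF in_S]]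
    have "((\<lambda>w. F (?\<gamma> t, w)) has_field_derivative B (?\<gamma> t, w)) (at w)"
      by (simp add: has_field_derivative_def)
    then show "((\<lambda>w. F (?\<gamma> t, w) * ?m t) has_field_derivative B (?\<gamma> t, w) * ?m t) (at w within cball 0 \<rho>)"
      by (intro DERIV_cmult_right) (rule has_field_derivative_at_within)
  next
    fix w :: complex assume w: "w \<in> cball 0 \<rho>"
    show "(\<lambda>t. F (?\<gamma> t, w) * ?m t) integrable_on cbox 0 1"
      using \<gamma>(1)
      by (intro integrable_continuous continuous_on_mult contm continuous_on_compose2[OF slice(1)[OF w] cont\<gamma>]) auto
  next
    have "continuous_on (cball 0 \<rho> \<times> cbox 0 1) (\<lambda>x. B (?\<gamma> (snd x), fst x) * ?m (snd x))"
      using sub \<gamma>(1)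
      by (intro continuous_on_mult continuous_on_compose2[OF B] continuous_on_compose2[OF contm[of UNIV]]
            continuous_on_Pair continuous_on_compose2[OF cont\<gamma>[of UNIV]] continuous_intros) auto
    then show "continuous_on (cball 0 \<rho> \<times> cbox 0 1) (\<lambda>(w, t). B (?\<gamma> t, w) * ?m t)"
      by (simp add: case_prod_unfold)
  qed
  then have "(\<lambda>w. fact i / (2 * pi * \<i>) * integral {0..1} (\<lambda>t. F (?\<gamma> t, w) * ?m t)) holomorphic_on cball 0 \<rho>"
    by (intro holomorphic_on_mult holomorphic_on_const) simp
  then show ?thesis using eq by (subst holomorphic_cong[OF refl]) auto
qed

text \<open>Expand in the first variable, then expand each coefficient, a holomorphic function of
  the second. Two Cauchy estimates bound the coefficients by M / \<rho> ^ (i + j); the double series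
  then converges absolutely and may be evaluated as an iterated sum.\<close>

lemma hol2_imp_psum:
  assumes "hol2 F S" "open S" "0 \<in> S"
  obtains c r where "0 < r" "majorized c r"
    "\<And>p. norm (fst p) < r \<Longrightarrow> norm (snd p) < r \<Longrightarrow> F p = psum c p"
proof -
  obtain U V where UV: "open U" "open V" "(0, 0) \<in> U \<times> V" "U \<times> V \<subseteq> S"
    using open_prod_elim[OF assms(2,3)] by (metis zero_prod_def)
  then obtain \<rho>1 \<rho>2 where "0 < \<rho>1" "cball 0 \<rho>1 \<subseteq> U" "0 < \<rho>2" "cball 0 \<rho>2 \<subseteq> V"
    by (metis mem_Sigma_iff open_contains_cball)
  define \<rho> where "\<rho> = min \<rho>1 \<rho>2"
  have \<rho>: "0 < \<rho>" using \<open>0 < \<rho>1\<close> \<open>0 < \<rho>2\<close> by (simp add: \<rho>_def)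
  have "cball 0 \<rho> \<times> cball 0 \<rho> \<subseteq> cball 0 \<rho>1 \<times> (cball 0 \<rho>2 :: complex set)" by (auto simp: \<rho>_def)
  then have sub: "cball 0 \<rho> \<times> cball 0 \<rho> \<subseteq> S"
    using UV(4) \<open>cball 0 \<rho>1 \<subseteq> U\<close> \<open>cball 0 \<rho>2 \<subseteq> V\<close> by blast
  let ?K = "cball 0 \<rho> \<times> cball 0 \<rho> :: (complex \<times> complex) set"
  have "compact (F ` ?K)"
    by (intro compact_continuous_image compact_Times continuous_on_subset[OF hol2_continuous_on[OF assms(1)]] sub) auto
  then obtain M where M: "\<And>p. p \<in> ?K \<Longrightarrow> norm (F p) \<le> M"
    by (metis bounded_iff compact_imp_bounded image_eqI)
  define b where "b i w = (deriv ^^ i) (\<lambda>z. F (z, w)) 0 / fact i" for i w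
  define c where "c k = (deriv ^^ snd k) (b (fst k)) 0 / fact (snd k)" for k :: "nat \<times> nat"
  have hol_b: "b i holomorphic_on cball 0 \<rho>" for i
    unfolding b_def[abs_def] by (intro holomorphic_on_divide hol2_deriv_holomorphic[OF assms(1) sub \<rho>]) auto
  have hol_F: "(\<lambda>z. F (z, w)) holomorphic_on cball 0 \<rho>" if "w \<in> cball 0 \<rho>" for w
    using hol2_slices(1)[OF assms(1) sub that] .
  have b_le: "norm (b i w) \<le> M / \<rho> ^ i" if w: "w \<in> cball 0 \<rho>" for i w
  proof -
    have "norm ((deriv ^^ i) (\<lambda>z. F (z, w)) 0) \<le> fact i * M / \<rho> ^ i"
      by (rule Cauchy_inequality[OF holomorphic_on_subset[OF hol_F[OF w] ball_subset_cball]
            holomorphic_on_imp_continuous_on[OF hol_F[OF w]] \<rho>]) (use w in \<open>auto intro!: M\<close>)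
    then show ?thesis by (simp add: b_def norm_divide field_simps)
  qed
  have c_le: "norm (c (i, j)) \<le> M / \<rho> ^ (i + j)" for i j
  proof -
    have "norm ((deriv ^^ j) (b i) 0) \<le> fact j * (M / \<rho> ^ i) / \<rho> ^ j"
      by (rule Cauchy_inequality[OF holomorphic_on_subset[OF hol_b ball_subset_cball]
            holomorphic_on_imp_continuous_on[OF hol_b] \<rho>]) (rule b_le, simp)
    then show ?thesis by (simp add: c_def norm_divide power_add field_simps)
  qed
  define r where "r = \<rho> / 2"
  have r: "0 < r" "r < \<rho>" using \<rho> by (auto simp: r_def)
  have maj: "majorized c r" using majorized_geometric[OF c_le r] .
  have "F p = psum c p" if p: "norm (fst p) < r" "norm (snd p) < r" for p
  proof -
    obtain z w where pzw: "p = (z, w)" by force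
    have zw: "z \<in> ball 0 \<rho>" "w \<in> ball 0 \<rho>" using p r by (auto simp: pzw)
    have sum_p: "((\<lambda>k. c k * z ^ fst k * w ^ snd k) has_sum psum c p) (UNIV \<times> UNIV)"
      using majorized_has_sum[OF maj, of p] p by (simp add: pzw)
    have inner: "((\<lambda>j. c (i, j) * z ^ i * w ^ j) has_sum (b i w * z ^ i)) UNIV" for i
    proof -
      \<comment> \<open>Summability of the row comes from the double series, its value from the
        one-variable Taylor series.\<close>
      have summ: "(\<lambda>j. c (i, j) * z ^ i * w ^ j) summable_on UNIV"
        using summable_on_SigmaD1[of "\<lambda>i j. c (i, j) * z ^ i * w ^ j" UNIV "\<lambda>_. UNIV" i]
          has_sum_imp_summable[OF sum_p] by (simp add: case_prod_unfold)
      have "(\<lambda>j. (deriv ^^ j) (b i) 0 / fact j * (w - 0) ^ j) sums b i w"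
        by (rule holomorphic_power_series[OF holomorphic_on_subset[OF hol_b ball_subset_cball] zw(2)])
      then have "(\<lambda>j. c (i, j) * w ^ j * z ^ i) sums (b i w * z ^ i)"
        by (intro sums_mult2) (simp add: c_def)
      then have "(\<lambda>j. c (i, j) * z ^ i * w ^ j) sums (b i w * z ^ i)"
        by (simp add: mult_ac)
      from sums_unique2[OF has_sum_imp_sums[OF has_sum_infsum[OF summ]] this] has_sum_infsum[OF summ]
      show ?thesis by simp
    qed
    have "((\<lambda>i. b i w * z ^ i) has_sum psum c p) UNIV"
      by (rule has_sum_SigmaD[OF sum_p]) (use inner in auto)
    then have "(\<lambda>i. b i w * z ^ i) sums psum c p" by (rule has_sum_imp_sums)
    moreover
    have "(\<lambda>i. (deriv ^^ i) (\<lambda>z. F (z, w)) 0 / fact i * (z - 0) ^ i) sums F (z, w)"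
      by (rule holomorphic_power_series[OF holomorphic_on_subset[OF hol_F ball_subset_cball] zw(1)])
         (use zw in auto)
    then have "(\<lambda>i. b i w * z ^ i) sums F p" by (simp add: b_def pzw)
    ultimately show ?thesis using sums_unique2 by blast
  qed
  with r(1) maj show ?thesis using that by blast
qed

subsection \<open>Real-analytic germs\<close>

abbreviation re_im :: "complex \<Rightarrow> complex \<times> complex" where
  "re_im z \<equiv> (complex_of_real (Re z), complex_of_real (Im z))"

text \<open>The map \<iota> serves two cases: the identity for complex values, and the embedding of
  the reals, where it records that the coefficients are real. Real coefficients later make the
  extension commute with conjugation.\<close>

lemma real_analytic_imp_psum_gen:
  fixes f :: "complex \<Rightarrow> 'a::real_normed_vector" and \<iota> :: "'a \<Rightarrow> complex"
  assumes "real_analytic_at f 0" and \<iota>: "bounded_linear \<iota>"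
  obtains a r where "0 < r" "majorized (\<lambda>k. \<iota> (a k)) r"
    "\<And>z. norm z < r \<Longrightarrow> \<iota> (f z) = psum (\<lambda>k. \<iota> (a k)) (re_im z)"
proof -
  interpret \<iota>: bounded_linear \<iota> by fact
  obtain b R where R: "R > 0"
    and b: "\<And>w. w \<in> ball 0 R \<Longrightarrow> ((\<lambda>(i, j). (Re (w - 0) ^ i * Im (w - 0) ^ j) *\<^sub>R b i j) has_sum f w) UNIV"
    using assms(1) unfolding real_analytic_at_def by blast
  define a where "a k = b (fst k) (snd k)" for k
  have sum_w: "((\<lambda>k. \<iota> (a k) * of_real (Re w) ^ fst k * of_real (Im w) ^ snd k) has_sum \<iota> (f w)) UNIV"
    if "norm w < R" for w
  proof -
    have "((\<lambda>k. (Re w ^ fst k * Im w ^ snd k) *\<^sub>R a k) has_sum f w) UNIV"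
      using b[of w] that by (simp add: a_def case_prod_unfold)
    from has_sum_bounded_linear[OF \<iota> this]
    show ?thesis by (simp add: o_def \<iota>.scaleR scaleR_conv_of_real mult_ac)
  qed
  define r where "r = R / 2"
  have r: "0 < r" "r < R" using R by (auto simp: r_def)
  \<comment> \<open>Both coordinates of this point equal r, so convergence there is convergence at
    the corner of the bidisc. Its norm is r sqrt 2, which the choice r = R / 2 keeps below
    R.\<close>
  have "norm (Complex r r) = sqrt (2 * r\<^sup>2)" by (simp add: complex_norm)
  also have "\<dots> < R"
    using R by (intro real_less_lsqrt) (auto simp: r_def power2_eq_square)
  finally have "((\<lambda>k. \<iota> (a k) * of_real r ^ fst k * of_real r ^ snd k) has_sum \<iota> (f (Complex r r))) UNIV"
    using sum_w[of "Complex r r"] by simp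
  then have "(\<lambda>k. norm (\<iota> (a k) * of_real r ^ fst k * of_real r ^ snd k)) summable_on UNIV"
    by (simp only: summable_on_iff_abs_summable_on_complex[symmetric] has_sum_imp_summable)
  then have "majorized (\<lambda>k. \<iota> (a k)) r"
    unfolding majorized_def using r by (simp add: norm_mult norm_power power_add mult_ac)
  moreover have "\<iota> (f z) = psum (\<lambda>k. \<iota> (a k)) (re_im z)" if "norm z < r" for z
    using infsumI[OF sum_w[of z]] that r by (simp add: psum_def)
  ultimately show ?thesis using that r by blast
qed

lemma norm_re_im: "norm (fst (re_im z)) \<le> norm z" "norm (snd (re_im z)) \<le> norm z"
  by (auto simp: abs_Re_le_cmod abs_Im_le_cmod)

lemma psum_imp_real_analytic:
  assumes "0 < r" "majorized c r" "\<And>z. norm z < r \<Longrightarrow> f z = psum c (re_im z)"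
  shows "real_analytic_at f 0"
  unfolding real_analytic_at_def
proof (intro exI conjI ballI)
  fix w :: complex assume w: "w \<in> ball 0 r"
  have "((\<lambda>k. c k * fst (re_im w) ^ fst k * snd (re_im w) ^ snd k) has_sum psum c (re_im w)) UNIV"
    using order_trans[OF norm_re_im(1)[of w], of r] order_trans[OF norm_re_im(2)[of w], of r] w
    by (intro majorized_has_sum[OF assms(2)]) auto
  then show "((\<lambda>(i, j). (Re (w - 0) ^ i * Im (w - 0) ^ j) *\<^sub>R c (i, j)) has_sum f w) UNIV"
    using assms(3)[of w] w by (simp add: case_prod_unfold scaleR_conv_of_real mult_ac)
qed (use assms in auto)

lemma real_analytic_of_real:
  assumes "real_analytic_at u 0"
  shows "real_analytic_at (\<lambda>z. complex_of_real (u z)) 0"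
proof -
  obtain a r where "0 < r" "majorized (\<lambda>k. complex_of_real (a k)) r"
      "\<And>z. norm z < r \<Longrightarrow> complex_of_real (u z) = psum (\<lambda>k. of_real (a k)) (re_im z)"
    by (rule real_analytic_imp_psum_gen[OF assms bounded_linear_of_real]) blast
  then show ?thesis by (rule psum_imp_real_analytic)
qed

lemma real_analytic_bounded_linear:
  assumes "real_analytic_at f z" "bounded_linear l"
  shows "real_analytic_at (\<lambda>z. l (f z)) z"
proof -
  interpret l: bounded_linear l by fact
  obtain b R where R: "R > 0"
    and b: "\<And>w. w \<in> ball z R \<Longrightarrow> ((\<lambda>(i, j). (Re (w - z) ^ i * Im (w - z) ^ j) *\<^sub>R b i j) has_sum f w) UNIV"
    using assms(1) unfolding real_analytic_at_def by blast
  have "((\<lambda>(i, j). (Re (w - z) ^ i * Im (w - z) ^ j) *\<^sub>R l (b i j)) has_sum l (f w)) UNIV" if "w \<in> ball z R" for w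
    using has_sum_bounded_linear[OF assms(2) b[OF that]]
    by (simp add: o_def case_prod_unfold l.scaleR)
  with R show ?thesis unfolding real_analytic_at_def
    by (intro exI[of _ "\<lambda>i j. l (b i j)"] exI[of _ R] conjI ballI)
qed

lemma real_analytic_hol2_ext:
  assumes "real_analytic_at f 0"
  obtains F r where "0 < r" "hol2 F (ball 0 r \<times> ball 0 r)" "\<And>z. norm z < r \<Longrightarrow> f z = F (re_im z)"
proof -
  obtain c R where c: "0 < R" "majorized c R" "\<And>z. norm z < R \<Longrightarrow> f z = psum c (re_im z)"
    using real_analytic_imp_psum_gen[OF assms bounded_linear_ident] by metis
  show ?thesis
    by (rule that[of "R / 2"], use c in simp, rule hol2_psum[OF c(2)]) (use c in auto)
qed

text \<open>Together with \<open>real_analytic_hol2_ext\<close> this is the dictionary between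
  real-analytic germs of the plane and holomorphic germs in two variables; sums, products and
  compositions are treated on the holomorphic side.\<close>

lemma hol2_imp_real_analytic:
  assumes "hol2 F S" "open S" "0 \<in> S" "\<forall>\<^sub>F z in nhds 0. f z = F (re_im z)"
  shows "real_analytic_at f 0"
proof -
  obtain c r where c: "0 < r" "majorized c r" "\<And>p. norm (fst p) < r \<Longrightarrow> norm (snd p) < r \<Longrightarrow> F p = psum c p"
    using hol2_imp_psum[OF assms(1-3)] by metis
  obtain s where s: "0 < s" "\<And>z. norm z < s \<Longrightarrow> f z = F (re_im z)"
    using assms(4) unfolding eventually_nhds_metric by auto
  define t where "t = min r s"
  show ?thesis
  proof (rule psum_imp_real_analytic)
    show "majorized c t" by (rule majorized_mono[OF c(2)]) (use c s in \<open>auto simp: t_def\<close>)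
    show "f z = psum c (re_im z)" if "norm z < t" for z
      using that s(2)[of z] c(3)[of "re_im z"]
        le_less_trans[OF norm_re_im(1)[of z], of r] le_less_trans[OF norm_re_im(2)[of z], of r]
      by (auto simp: t_def)
  qed (use c s in \<open>auto simp: t_def\<close>)
qed

section \<open>Closure properties of holomorphic functions of two variables\<close>

lemma hol2I:
  assumes "continuous_on S A" "continuous_on S B"
    "\<And>p. p \<in> S \<Longrightarrow> (F has_derivative (\<lambda>h. A p * fst h + B p * snd h)) (at p)"
  shows "hol2 F S"
  using assms unfolding hol2_def by (intro exI[of _ A] exI[of _ B]) simp

lemma hol2_const: "hol2 (\<lambda>_. a) S"
  unfolding hol2_def by (rule exI[of _ "\<lambda>_. 0"], rule exI[of _ "\<lambda>_. 0"]) auto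

lemma hol2_fst: "hol2 fst S"
  unfolding hol2_def
  by (rule exI[of _ "\<lambda>_. 1"], rule exI[of _ "\<lambda>_. 0"]) (auto intro!: derivative_eq_intros)

lemma hol2_snd: "hol2 snd S"
  unfolding hol2_def
  by (rule exI[of _ "\<lambda>_. 0"], rule exI[of _ "\<lambda>_. 1"]) (auto intro!: derivative_eq_intros)

lemma hol2_add:
  assumes "hol2 F S" "hol2 G S"
  shows "hol2 (\<lambda>p. F p + G p) S"
proof -
  obtain A B where A: "continuous_on S A" "continuous_on S B"
      "\<And>p. p \<in> S \<Longrightarrow> (F has_derivative (\<lambda>h. A p * fst h + B p * snd h)) (at p)"
    using assms(1) unfolding hol2_def by blast
  obtain A' B' where A': "continuous_on S A'" "continuous_on S B'"
      "\<And>p. p \<in> S \<Longrightarrow> (G has_derivative (\<lambda>h. A' p * fst h + B' p * snd h)) (at p)"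
    using assms(2) unfolding hol2_def by blast
  have "((\<lambda>p. F p + G p) has_derivative (\<lambda>h. (A p + A' p) * fst h + (B p + B' p) * snd h)) (at p)" if "p \<in> S" for p
    using has_derivative_add[OF A(3)[OF that] A'(3)[OF that]] by (simp add: algebra_simps)
  then show ?thesis
    by (intro hol2I[of S "\<lambda>p. A p + A' p" "\<lambda>p. B p + B' p"] continuous_on_add A(1,2) A'(1,2))
qed

lemma hol2_mult:
  assumes "hol2 F S" "hol2 G S"
  shows "hol2 (\<lambda>p. F p * G p) S"
proof -
  obtain A B where A: "continuous_on S A" "continuous_on S B"
      "\<And>p. p \<in> S \<Longrightarrow> (F has_derivative (\<lambda>h. A p * fst h + B p * snd h)) (at p)"
    using assms(1) unfolding hol2_def by blast
  obtain A' B' where A': "continuous_on S A'" "continuous_on S B'"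
      "\<And>p. p \<in> S \<Longrightarrow> (G has_derivative (\<lambda>h. A' p * fst h + B' p * snd h)) (at p)"
    using assms(2) unfolding hol2_def by blast
  have "((\<lambda>p. F p * G p) has_derivative
      (\<lambda>h. (F p * A' p + A p * G p) * fst h + (F p * B' p + B p * G p) * snd h)) (at p)" if "p \<in> S" for p
    using has_derivative_mult[OF A(3)[OF that] A'(3)[OF that]] by (simp add: algebra_simps)
  note der = this
  have "continuous_on S (\<lambda>p. F p * A' p + A p * G p)" "continuous_on S (\<lambda>p. F p * B' p + B p * G p)"
    by (intro continuous_intros A(1,2) A'(1,2) hol2_continuous_on assms)+
  from hol2I[OF this der] show ?thesis .
qed

lemma hol2_compose:
  assumes "hol2 F T" "hol2 G S" "hol2 H S" "\<And>p. p \<in> S \<Longrightarrow> (G p, H p) \<in> T"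
  shows "hol2 (\<lambda>p. F (G p, H p)) S"
proof -
  obtain A B where A: "continuous_on T A" "continuous_on T B"
      "\<And>p. p \<in> T \<Longrightarrow> (F has_derivative (\<lambda>h. A p * fst h + B p * snd h)) (at p)"
    using assms(1) unfolding hol2_def by blast
  obtain C D where C: "continuous_on S C" "continuous_on S D"
      "\<And>p. p \<in> S \<Longrightarrow> (G has_derivative (\<lambda>h. C p * fst h + D p * snd h)) (at p)"
    using assms(2) unfolding hol2_def by blast
  obtain C' D' where C': "continuous_on S C'" "continuous_on S D'"
      "\<And>p. p \<in> S \<Longrightarrow> (H has_derivative (\<lambda>h. C' p * fst h + D' p * snd h)) (at p)"
    using assms(3) unfolding hol2_def by blast
  let ?GH = "\<lambda>p. (G p, H p)"
  have GH: "continuous_on S ?GH" using assms hol2_continuous_on by (intro continuous_on_Pair) auto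
  have AB: "continuous_on S (\<lambda>p. A (?GH p))" "continuous_on S (\<lambda>p. B (?GH p))"
    by (rule continuous_on_compose2[OF A(1) GH] continuous_on_compose2[OF A(2) GH]; use assms(4) in auto)+
  have "((\<lambda>p. F (?GH p)) has_derivative
      (\<lambda>h. (A (?GH p) * C p + B (?GH p) * C' p) * fst h + (A (?GH p) * D p + B (?GH p) * D' p) * snd h)) (at p)"
    if "p \<in> S" for p
    using has_derivative_compose[where g = F, OF has_derivative_Pair[OF C(3)[OF that] C'(3)[OF that]]
        A(3)[OF assms(4)[OF that]]]
    by (simp add: algebra_simps)
  note der = this
  have "continuous_on S (\<lambda>p. A (?GH p) * C p + B (?GH p) * C' p)"
      "continuous_on S (\<lambda>p. A (?GH p) * D p + B (?GH p) * D' p)"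
    by (intro continuous_intros AB C(1,2) C'(1,2))+
  from hol2I[OF this der] show ?thesis .
qed

section \<open>Closure properties of real-analytic germs\<close>

lemma open_polydisc: "open (ball 0 r \<times> ball 0 r :: (complex \<times> complex) set)"
  by (intro open_Times) auto

lemma real_analytic_binop:
  fixes f g :: "complex \<Rightarrow> complex"
  assumes "real_analytic_at f 0" "real_analytic_at g 0"
    and op: "\<And>F G S. hol2 F S \<Longrightarrow> hol2 G S \<Longrightarrow> hol2 (\<lambda>p. op (F p) (G p)) S"
  shows "real_analytic_at (\<lambda>z. op (f z) (g z)) 0"
proof -
  obtain F r where F: "0 < r" "hol2 F (ball 0 r \<times> ball 0 r)" "\<And>z. norm z < r \<Longrightarrow> f z = F (re_im z)"
    by (rule real_analytic_hol2_ext[OF assms(1)]) (rule that)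
  obtain G s where G: "0 < s" "hol2 G (ball 0 s \<times> ball 0 s)" "\<And>z. norm z < s \<Longrightarrow> g z = G (re_im z)"
    by (rule real_analytic_hol2_ext[OF assms(2)]) (rule that)
  define t where "t = min r s"
  have t: "0 < t" "t \<le> r" "t \<le> s" using F G by (auto simp: t_def)
  have "hol2 (\<lambda>p. op (F p) (G p)) (ball 0 t \<times> ball 0 t)"
    by (rule op; rule hol2_subset, rule F(2) G(2), use t in auto)
  then show ?thesis
  proof (rule hol2_imp_real_analytic[OF _ open_polydisc])
    have "\<forall>\<^sub>F z in nhds (0::complex). norm z < t"
      using t(1) by (auto simp: eventually_nhds_metric)
    then show "\<forall>\<^sub>F z in nhds 0. op (f z) (g z) = op (F (re_im z)) (G (re_im z))"
      by eventually_elim (use t F G in auto)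
  qed (use t in \<open>auto simp: zero_prod_def\<close>)
qed

lemma real_analytic_const: "real_analytic_at (\<lambda>_. a :: complex) 0"
  by (rule hol2_imp_real_analytic[OF hol2_const[of a UNIV]]) auto

lemma real_analytic_add:
  fixes f g :: "complex \<Rightarrow> complex"
  assumes "real_analytic_at f 0" "real_analytic_at g 0"
  shows "real_analytic_at (\<lambda>z. f z + g z) 0"
  by (rule real_analytic_binop[OF assms]) (rule hol2_add)

lemma real_analytic_mult:
  fixes f g :: "complex \<Rightarrow> complex"
  assumes "real_analytic_at f 0" "real_analytic_at g 0"
  shows "real_analytic_at (\<lambda>z. f z * g z) 0"
  by (rule real_analytic_binop[OF assms]) (rule hol2_mult)

lemma real_analytic_diff:
  fixes f g :: "complex \<Rightarrow> complex"
  assumes "real_analytic_at f 0" "real_analytic_at g 0"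
  shows "real_analytic_at (\<lambda>z. f z - g z) 0"
  using real_analytic_add[OF assms(1) real_analytic_mult[OF real_analytic_const[of "-1"] assms(2)]] by simp

lemma real_analytic_sum:
  fixes f :: "'i \<Rightarrow> complex \<Rightarrow> complex"
  assumes "\<And>i. i \<in> A \<Longrightarrow> real_analytic_at (f i) 0"
  shows "real_analytic_at (\<lambda>z. \<Sum>i\<in>A. f i z) 0"
  using assms by (induction A rule: infinite_finite_induct) (auto intro: real_analytic_const real_analytic_add)

lemma real_analytic_power:
  fixes f :: "complex \<Rightarrow> complex"
  assumes "real_analytic_at f 0"
  shows "real_analytic_at (\<lambda>z. f z ^ n) 0"
  by (induction n) (auto intro: real_analytic_const real_analytic_mult assms)

lemma real_analytic_Re: "real_analytic_at (\<lambda>z. complex_of_real (Re z)) 0"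
  by (rule hol2_imp_real_analytic[OF hol2_fst[of UNIV]]) auto

lemma real_analytic_Im: "real_analytic_at (\<lambda>z. complex_of_real (Im z)) 0"
  by (rule hol2_imp_real_analytic[OF hol2_snd[of UNIV]]) auto

lemma real_analytic_ident: "real_analytic_at (\<lambda>z::complex. z) 0"
  using real_analytic_add[OF real_analytic_Re real_analytic_mult[OF real_analytic_const real_analytic_Im], of \<i>]
  by (simp add: complex_eq[symmetric])

lemma real_analytic_compose:
  fixes f g :: "complex \<Rightarrow> complex"
  assumes "real_analytic_at f 0" "real_analytic_at g 0" "g 0 = 0"
  shows "real_analytic_at (\<lambda>z. f (g z)) 0"
proof -
  obtain F r where F: "0 < r" "hol2 F (ball 0 r \<times> ball 0 r)" "\<And>z. norm z < r \<Longrightarrow> f z = F (re_im z)"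
    by (rule real_analytic_hol2_ext[OF assms(1)]) (rule that)
  \<comment> \<open>The outer function sees the real coordinates of g z, so Re g and Im g receive
    their own holomorphic extensions; the real part of an extension of g would not be holomorphic in
    general.\<close>
  have ReIm: "real_analytic_at (\<lambda>z. complex_of_real (Re (g z))) 0" "real_analytic_at (\<lambda>z. complex_of_real (Im (g z))) 0"
    by (rule real_analytic_of_real[OF real_analytic_bounded_linear[OF assms(2) bounded_linear_Re]]
        real_analytic_of_real[OF real_analytic_bounded_linear[OF assms(2) bounded_linear_Im]])+
  obtain G s where G: "0 < s" "hol2 G (ball 0 s \<times> ball 0 s)" "\<And>z. norm z < s \<Longrightarrow> complex_of_real (Re (g z)) = G (re_im z)"
    by (rule real_analytic_hol2_ext[OF ReIm(1)]) (rule that)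
  obtain H t where H: "0 < t" "hol2 H (ball 0 t \<times> ball 0 t)" "\<And>z. norm z < t \<Longrightarrow> complex_of_real (Im (g z)) = H (re_im z)"
    by (rule real_analytic_hol2_ext[OF ReIm(2)]) (rule that)
  define u where "u = min s t"
  have u: "0 < u" "u \<le> s" "u \<le> t" using H G by (auto simp: u_def)
  let ?P = "ball 0 u \<times> ball 0 u :: (complex \<times> complex) set"
  have GH: "hol2 G ?P" "hol2 H ?P"
    by (rule hol2_subset, rule G(2) H(2), use u in auto)+
  let ?S = "?P \<inter> (\<lambda>p. (G p, H p)) -` (ball 0 r \<times> ball 0 r)"
  have "open ?S"
    by (intro continuous_open_preimage continuous_on_Pair hol2_continuous_on GH open_polydisc)
  have 0: "G 0 = 0" "H 0 = 0" using G(3)[of 0] H(3)[of 0] G(1) H(1) assms(3) by (auto simp: zero_prod_def)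
  have hol: "hol2 (\<lambda>p. F (G p, H p)) ?S"
    by (rule hol2_compose[OF F(2)]) (auto intro: hol2_subset[OF GH(1)] hol2_subset[OF GH(2)])
  show ?thesis
  proof (rule hol2_imp_real_analytic[OF hol \<open>open ?S\<close>])
    show "0 \<in> ?S" using 0 u F(1) by (auto simp: zero_prod_def)
    \<comment> \<open>This extension serves to show that g is continuous at 0, which keeps g z where
      the extension F represents f.\<close>
    obtain G' r' where G': "0 < r'" "hol2 G' (ball 0 r' \<times> ball 0 r')" "\<And>z. norm z < r' \<Longrightarrow> g z = G' (re_im z)"
      by (rule real_analytic_hol2_ext[OF assms(2)]) (rule that)
    have "continuous_on (ball 0 r') (\<lambda>z. G' (re_im z))"
      by (rule continuous_on_compose2[OF hol2_continuous_on[OF G'(2)]])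
         (auto intro!: continuous_intros intro: le_less_trans[OF abs_Re_le_cmod] le_less_trans[OF abs_Im_le_cmod])
    then have "continuous_on (ball 0 r') g"
      by (rule continuous_on_eq) (use G' in auto)
    then have "isCont g 0" using G'(1) by (simp add: continuous_on_eq_continuous_at)
    then have "(g \<longlongrightarrow> 0) (nhds 0)"
      using assms(3) tendsto_at_iff_tendsto_nhds[of g 0] by (simp add: isCont_def)
    then have "\<forall>\<^sub>F z in nhds 0. g z \<in> ball 0 r"
      by (rule topological_tendstoD) (use F(1) in auto)
    moreover have "\<forall>\<^sub>F z in nhds (0::complex). norm z < u"
      using u(1) by (auto simp: eventually_nhds_metric)
    ultimately show "\<forall>\<^sub>F z in nhds 0. f (g z) = F (G (re_im z), H (re_im z))"
    proof eventually_elim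
      case (elim z)
      then show ?case using F(3)[of "g z"] G(3)[of z] H(3)[of z] u by auto
    qed
  qed
qed

subsection \<open>Order of vanishing and leading forms\<close>

lemma eventually_nhds_0_norm_less: "0 < r \<Longrightarrow> \<forall>\<^sub>F z in nhds (0::complex). norm z < r"
  by (auto simp: eventually_nhds_metric)

definition order_ge :: "nat \<Rightarrow> (complex \<Rightarrow> complex) \<Rightarrow> bool" where
  "order_ge N f \<longleftrightarrow> (\<exists>C. \<forall>\<^sub>F z in nhds 0. norm (f z) \<le> C * norm z ^ N)"

text \<open>The little-o companion of \<open>order_ge\<close>. It kills homogeneous polynomials of
  degree N, and for analytic germs it upgrades to order N + 1
  (\<open>real_analytic_order_Suc\<close>).\<close>

definition order_gt :: "nat \<Rightarrow> (complex \<Rightarrow> complex) \<Rightarrow> bool" where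
  "order_gt N f \<longleftrightarrow> (\<forall>e>0. \<forall>\<^sub>F z in nhds 0. norm (f z) \<le> e * norm z ^ N)"

lemma order_geE:
  assumes "order_ge N f"
  obtains C r where "0 < C" "0 < r" "\<And>z. norm z < r \<Longrightarrow> norm (f z) \<le> C * norm z ^ N"
proof -
  obtain C where "\<forall>\<^sub>F z in nhds 0. norm (f z) \<le> C * norm z ^ N"
    using assms unfolding order_ge_def by blast
  then obtain r where r: "0 < r" "\<And>z. norm z < r \<Longrightarrow> norm (f z) \<le> C * norm z ^ N"
    unfolding eventually_nhds_metric by auto
  have "norm (f z) \<le> max C 1 * norm z ^ N" if "norm z < r" for z
    by (rule order_trans[OF r(2)[OF that]]) (auto intro!: mult_right_mono)
  with r(1) show ?thesis using that[of "max C 1" r] by auto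
qed

lemma order_geI: "0 < r \<Longrightarrow> (\<And>z. norm z < r \<Longrightarrow> norm (f z) \<le> C * norm z ^ N) \<Longrightarrow> order_ge N f"
  unfolding order_ge_def eventually_nhds_metric
  by (rule exI[of _ C], rule exI[of _ r]) simp

lemma order_ge_cong:
  assumes "order_ge N f" "\<forall>\<^sub>F z in nhds 0. f z = g z"
  shows "order_ge N g"
proof -
  obtain C where C: "\<forall>\<^sub>F z in nhds 0. norm (f z) \<le> C * norm z ^ N"
    using assms unfolding order_ge_def by blast
  from C assms(2) have "\<forall>\<^sub>F z in nhds 0. norm (g z) \<le> C * norm z ^ N"
    by eventually_elim simp
  then show ?thesis unfolding order_ge_def by blast
qed

lemma order_gt_cong:
  assumes "order_gt N f" "\<forall>\<^sub>F z in nhds 0. f z = g z"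
  shows "order_gt N g"
  unfolding order_gt_def
proof (intro allI impI)
  fix e :: real assume "0 < e"
  then have "\<forall>\<^sub>F z in nhds 0. norm (f z) \<le> e * norm z ^ N" using assms(1) unfolding order_gt_def by blast
  with assms(2) show "\<forall>\<^sub>F z in nhds 0. norm (g z) \<le> e * norm z ^ N"
    by eventually_elim simp
qed

lemma order_ge_add:
  assumes "order_ge N f" "order_ge N g"
  shows "order_ge N (\<lambda>z. f z + g z)"
proof -
  obtain C where C: "\<forall>\<^sub>F z in nhds 0. norm (f z) \<le> C * norm z ^ N"
    using assms unfolding order_ge_def by blast
  obtain D where D: "\<forall>\<^sub>F z in nhds 0. norm (g z) \<le> D * norm z ^ N"
    using assms unfolding order_ge_def by blast
  from C D have "\<forall>\<^sub>F z in nhds 0. norm (f z + g z) \<le> (C + D) * norm z ^ N"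
    by eventually_elim (auto simp: distrib_right intro: order_trans[OF norm_triangle_ineq] add_mono)
  then show ?thesis unfolding order_ge_def by blast
qed

lemma order_ge_mult:
  assumes "order_ge N f" "order_ge M g"
  shows "order_ge (N + M) (\<lambda>z. f z * g z)"
proof -
  obtain C r where C: "0 < C" "0 < r" "\<And>z. norm z < r \<Longrightarrow> norm (f z) \<le> C * norm z ^ N"
    by (rule order_geE[OF assms(1)]) (rule that)
  obtain D s where D: "0 < D" "0 < s" "\<And>z. norm z < s \<Longrightarrow> norm (g z) \<le> D * norm z ^ M"
    by (rule order_geE[OF assms(2)]) (rule that)
  have "norm (f z * g z) \<le> (C * D) * norm z ^ (N + M)" if "norm z < min r s" for z
  proof -
    have "norm (f z) * norm (g z) \<le> (C * norm z ^ N) * (D * norm z ^ M)"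
      using that C D by (intro mult_mono) auto
    then show ?thesis by (simp add: norm_mult power_add mult_ac)
  qed
  then show ?thesis using C D by (intro order_geI[of "min r s"]) auto
qed

lemma order_ge_const: "order_ge 0 (\<lambda>_. a)"
  unfolding order_ge_def by (rule exI[of _ "norm a"]) simp

lemma order_ge_cmult: "order_ge N f \<Longrightarrow> order_ge N (\<lambda>z. a * f z)"
  using order_ge_mult[OF order_ge_const] by fastforce

lemma order_ge_diff: "order_ge N f \<Longrightarrow> order_ge N g \<Longrightarrow> order_ge N (\<lambda>z. f z - g z)"
  using order_ge_add[of N f "\<lambda>z. - 1 * g z"] order_ge_cmult[of N g "-1"] by simp

lemma order_ge_mono:
  assumes "order_ge N f" "M \<le> N"
  shows "order_ge M f"
proof -
  obtain C r where C: "0 < C" "0 < r" "\<And>z. norm z < r \<Longrightarrow> norm (f z) \<le> C * norm z ^ N"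
    by (rule order_geE[OF assms(1)]) (rule that)
  have "norm (f z) \<le> C * norm z ^ M" if "norm z < min r 1" for z
  proof -
    have "norm z ^ N \<le> norm z ^ M" by (rule power_decreasing) (use assms(2) that in auto)
    then show ?thesis using C(3)[of z] that C(1) by (meson min_less_iff_conj mult_le_cancel_left_pos order_trans)
  qed
  then show ?thesis using C by (intro order_geI[of "min r 1"]) auto
qed

lemma order_ge_imp_gt:
  assumes "order_ge (Suc N) f"
  shows "order_gt N f"
  unfolding order_gt_def
proof (intro allI impI)
  fix e :: real assume e: "0 < e"
  obtain C r where C: "0 < C" "0 < r" "\<And>z. norm z < r \<Longrightarrow> norm (f z) \<le> C * norm z ^ Suc N"
    by (rule order_geE[OF assms]) (rule that)
  have "0 < min r (e / C)" using C e by simp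
  from eventually_nhds_0_norm_less[OF this]
  show "\<forall>\<^sub>F z in nhds 0. norm (f z) \<le> e * norm z ^ N"
  proof eventually_elim
    case (elim z)
    have "norm (f z) \<le> (C * norm z) * norm z ^ N" using C(3)[of z] elim by (simp add: mult_ac)
    also have "\<dots> \<le> e * norm z ^ N"
      using elim C by (intro mult_right_mono) (auto simp: field_simps)
    finally show ?case .
  qed
qed

lemma order_gt_diff:
  assumes "order_gt N f" "order_gt N g"
  shows "order_gt N (\<lambda>z. f z - g z)"
  unfolding order_gt_def
proof (intro allI impI)
  fix e :: real assume e: "0 < e"
  have "\<forall>\<^sub>F z in nhds 0. norm (f z) \<le> e / 2 * norm z ^ N" "\<forall>\<^sub>F z in nhds 0. norm (g z) \<le> e / 2 * norm z ^ N"
    using assms half_gt_zero[OF e] unfolding order_gt_def by blast+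
  then show "\<forall>\<^sub>F z in nhds 0. norm (f z - g z) \<le> e * norm z ^ N"
    by eventually_elim (rule order_trans[OF norm_triangle_ineq4], simp)
qed

section \<open>Homogeneous parts and truncations of power series\<close>

definition hpoly :: "nat \<Rightarrow> (nat \<Rightarrow> complex) \<Rightarrow> complex \<Rightarrow> complex" where
  "hpoly n d z = (\<Sum>i\<le>n. d i * of_real (Re z) ^ i * of_real (Im z) ^ (n - i))"

lemma hpoly_scale: "hpoly n d (of_real t * z) = of_real t ^ n * hpoly n d z"
  unfolding hpoly_def sum_distrib_left
proof (rule sum.cong[OF refl])
  fix i assume "i \<in> {..n}"
  then have "complex_of_real t ^ n = of_real t ^ i * of_real t ^ (n - i)" by (simp flip: power_add)
  then show "d i * complex_of_real (Re (complex_of_real t * z)) ^ i * complex_of_real (Im (complex_of_real t * z)) ^ (n - i) =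
      complex_of_real t ^ n * (d i * complex_of_real (Re z) ^ i * complex_of_real (Im z) ^ (n - i))"
    by (simp add: power_mult_distrib mult_ac)
qed

lemma real_analytic_hpoly: "real_analytic_at (hpoly n d) 0"
  unfolding hpoly_def[abs_def]
  by (intro real_analytic_sum real_analytic_mult real_analytic_const real_analytic_power real_analytic_Re real_analytic_Im)

text \<open>Scaling carries an estimate near 0 to an arbitrary point. P is general because the lemma
  is also applied to the difference between a rotated quadratic form and the form itself.\<close>

lemma homogeneous_eq_0_if_order_gt:
  assumes scale: "\<And>t z. P (of_real t * z) = of_real t ^ n * P z" and "order_gt n P"
  shows "P z = 0"
proof -
  have "norm (P z) \<le> e * norm z ^ n" if e: "0 < e" for e
  proof -
    obtain r where r: "0 < r" "\<And>z. norm z < r \<Longrightarrow> norm (P z) \<le> e * norm z ^ n"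
      using assms(2) e unfolding order_gt_def eventually_nhds_metric by auto
    define t where "t = r / (2 * (norm z + 1))"
    have t: "0 < t" using r(1) by (auto simp: t_def add_nonneg_pos)
    have "t * norm z < t * (2 * (norm z + 1))"
      using t by (intro mult_strict_left_mono) (auto intro: add_nonneg_pos)
    also have "t * (2 * (norm z + 1)) = r"
      using add_nonneg_pos[OF norm_ge_zero[of z] zero_less_one] by (simp add: t_def)
    finally have "t * norm z < r" .
    then have "norm (P (of_real t * z)) \<le> e * norm (of_real t * z) ^ n"
      using t by (intro r(2)) (simp add: norm_mult)
    then have "t ^ n * norm (P z) \<le> t ^ n * (e * norm z ^ n)"
      unfolding scale norm_mult norm_power using t by (simp add: power_mult_distrib mult_ac)
    then show ?thesis by (rule mult_left_le_imp_le) (use t in simp)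
  qed
  then have "\<forall>e>0. norm (P z) \<le> e * norm z ^ n" by blast
  moreover have "((\<lambda>e. e * norm z ^ n) \<longlongrightarrow> 0 * norm z ^ n) (at_right 0)"
    by (intro tendsto_intros)
  ultimately have "norm (P z) \<le> 0 * norm z ^ n"
    by (intro tendsto_lowerbound[of "\<lambda>e. e * norm z ^ n"]) (auto simp: eventually_at_right_less eventually_at_filter)
  then show ?thesis by simp
qed

lemma hpoly_eq_0_if_order_gt: "order_gt n (hpoly n d) \<Longrightarrow> hpoly n d z = 0"
  by (rule homogeneous_eq_0_if_order_gt[OF hpoly_scale])

definition trunc :: "nat \<Rightarrow> (nat \<times> nat \<Rightarrow> complex) \<Rightarrow> nat \<times> nat \<Rightarrow> complex" where
  "trunc N c k = (if fst k + snd k < N then 0 else c k)"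

lemma trunc_0: "trunc 0 c = c" by (auto simp: trunc_def)

lemma majorized_trunc:
  assumes "majorized c r" "0 \<le> r"
  shows "majorized (trunc N c) r"
  unfolding majorized_def
  by (rule summable_on_comparison_test[OF assms(1)[unfolded majorized_def]])
     (use assms(2) in \<open>auto simp: trunc_def\<close>)

lemma dx_trunc: "dx_coeff (trunc (Suc N) c) = trunc N (dx_coeff c)"
  and dy_trunc: "dy_coeff (trunc (Suc N) c) = trunc N (dy_coeff c)"
  by (auto simp: trunc_def dx_coeff_def dy_coeff_def fun_eq_iff)

text \<open>For |z| <= r a term of degree at least N gains the factor (|z| / r) ^ N over its
  majorant. The explicit dependence of the constant on N is what makes flat germs vanish.\<close>

lemma psum_trunc_le:
  assumes c: "majorized c r" and r: "0 < r" and z: "norm z \<le> r"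
  shows "norm (psum (trunc N c) (re_im z)) \<le> (\<Sum>\<^sub>\<infinity>k. norm (c k) * r ^ (fst k + snd k)) / r ^ N * norm z ^ N"
proof -
  let ?T = "\<lambda>k. trunc N c k * fst (re_im z) ^ fst k * snd (re_im z) ^ snd k"
  have le_r: "norm (fst (re_im z)) \<le> r" "norm (snd (re_im z)) \<le> r"
    using norm_re_im[of z] z by (meson order_trans)+
  have 1: "(?T has_sum psum (trunc N c) (re_im z)) UNIV"
    by (rule majorized_has_sum[OF majorized_trunc[OF c]]) (use r le_r in auto)
  have 2: "((\<lambda>k. norm (c k) * r ^ (fst k + snd k) * (norm z ^ N / r ^ N)) has_sum
      ((\<Sum>\<^sub>\<infinity>k. norm (c k) * r ^ (fst k + snd k)) * (norm z ^ N / r ^ N))) UNIV"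
    using c unfolding majorized_def by (intro has_sum_cmult_left has_sum_infsum)
  have "norm (?T k) \<le> norm (c k) * r ^ (fst k + snd k) * (norm z ^ N / r ^ N)" for k
  proof (cases "fst k + snd k < N")
    case False
    have "norm (?T k) \<le> norm (c k) * norm z ^ (fst k + snd k)"
      using majorized_term_le[OF norm_re_im, of c k z] False by (simp add: trunc_def)
    also have "norm z ^ (fst k + snd k) = r ^ (fst k + snd k) * (norm z / r) ^ (fst k + snd k)"
      using r by (simp add: power_divide)
    also have "norm (c k) * \<dots> \<le> norm (c k) * (r ^ (fst k + snd k) * (norm z / r) ^ N)"
      using False r z by (intro mult_left_mono power_decreasing) auto
    finally show ?thesis by (simp add: power_divide mult_ac)
  qed (use r in \<open>simp add: trunc_def\<close>)
  from norm_infsum_le[OF 1 2 this] show ?thesis by simp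
qed

lemma psum_trunc_step:
  assumes c: "majorized c r" and z: "norm z \<le> r"
  shows "psum (trunc n c) (re_im z) = hpoly n (\<lambda>i. c (i, n - i)) z + psum (trunc (Suc n) c) (re_im z)"
proof -
  have r: "0 \<le> r" using z order_trans[OF norm_ge_zero] by blast
  let ?t = "\<lambda>c k. c k * fst (re_im z) ^ fst k * snd (re_im z) ^ snd k"
  have le_r: "norm (fst (re_im z)) \<le> r" "norm (snd (re_im z)) \<le> r"
    using norm_re_im[of z] z by (meson order_trans)+
  have sums: "(?t (trunc N c) has_sum psum (trunc N c) (re_im z)) UNIV" for N
    by (rule majorized_has_sum[OF majorized_trunc[OF c r] le_r])
  let ?D = "(\<lambda>i. (i, n - i)) ` {..n}"
  let ?e = "\<lambda>k. if fst k + snd k = n then c k else 0"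
  have "(?t ?e has_sum hpoly n (\<lambda>i. c (i, n - i)) z) UNIV"
  proof (rule has_sum_finite_neutralI)
    show "finite ?D" by simp
    show "?t ?e x = 0" if "x \<in> UNIV - ?D" for x
      using that by (cases x) (auto simp: image_iff)
    have "inj_on (\<lambda>i. (i, n - i)) {..n}" by (auto simp: inj_on_def)
    then show "hpoly n (\<lambda>i. c (i, n - i)) z = (\<Sum>x\<in>?D. ?t ?e x)"
      by (simp add: sum.reindex hpoly_def)
  qed auto
  from has_sum_add[OF this sums[of "Suc n"]]
  have "(?t (trunc n c) has_sum (hpoly n (\<lambda>i. c (i, n - i)) z + psum (trunc (Suc n) c) (re_im z))) UNIV"
    by (rule has_sum_cong[THEN iffD1, rotated]) (auto simp: trunc_def)
  then show ?thesis using has_sum_unique sums[of n] by blast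
qed

lemma psum_trunc_order_ge:
  assumes "majorized c r" "0 < r"
  shows "order_ge N (\<lambda>z. psum (trunc N c) (re_im z))"
  by (rule order_geI[OF assms(2)]) (rule psum_trunc_le[OF assms less_imp_le])

text \<open>Induction on the order: the part of degree N is f minus a remainder of higher order,
  hence o(|z| ^ N), and vanishes by homogeneity.\<close>

lemma psum_eq_trunc:
  assumes c: "majorized c r" and r: "0 < r"
    and f: "\<And>z. norm z < r \<Longrightarrow> f z = psum c (re_im z)"
  shows "order_ge N f \<Longrightarrow> norm z < r \<Longrightarrow> f z = psum (trunc N c) (re_im z)"
proof (induction N arbitrary: z)
  case 0
  then show ?case by (simp add: trunc_0 f)
next
  case (Suc N)
  let ?P = "hpoly N (\<lambda>i. c (i, N - i))"
  have IH: "f z = ?P z + psum (trunc (Suc N) c) (re_im z)" if "norm z < r" for z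
    using Suc.IH[OF order_ge_mono[OF Suc.prems(1)] that] psum_trunc_step[OF c, of z N] that by simp
  have "order_gt N (\<lambda>z. f z - psum (trunc (Suc N) c) (re_im z))"
    by (intro order_gt_diff order_ge_imp_gt Suc.prems psum_trunc_order_ge[OF c r])
  moreover have "\<forall>\<^sub>F z in nhds 0. f z - psum (trunc (Suc N) c) (re_im z) = ?P z"
    using eventually_nhds_0_norm_less[OF r] by eventually_elim (simp add: IH)
  ultimately have "order_gt N ?P" by (rule order_gt_cong)
  then show ?case using IH[OF Suc.prems(2)] hpoly_eq_0_if_order_gt by simp
qed

section \<open>Orders of vanishing of real-analytic germs and their derivatives\<close>

lemma real_analytic_psum:
  assumes "real_analytic_at (f :: complex \<Rightarrow> complex) 0"
  obtains c r where "0 < r" "majorized c r" "\<And>z. norm z < r \<Longrightarrow> f z = psum c (re_im z)"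
  by (rule real_analytic_imp_psum_gen[OF assms bounded_linear_ident]) (rule that)

text \<open>The neighbourhoods hidden in \<open>order_ge\<close> may shrink with N, so the bound
  goes through the series: there the radius r and the sum \<open>?M\<close> are the same for all N,
  and N may grow while z stays fixed.\<close>

lemma real_analytic_flat_eq_0:
  assumes "real_analytic_at f 0" "\<And>N. order_ge N f"
  shows "\<forall>\<^sub>F z in nhds 0. f z = 0"
proof -
  obtain c r where c: "0 < r" "majorized c r" "\<And>z. norm z < r \<Longrightarrow> f z = psum c (re_im z)"
    by (rule real_analytic_psum[OF assms(1)]) (rule that)
  let ?M = "\<Sum>\<^sub>\<infinity>k. norm (c k) * r ^ (fst k + snd k)"
  have "f z = 0" if z: "norm z < r" for z
  proof -
    have "norm (f z) \<le> ?M * (norm z / r) ^ N" for N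
      using psum_trunc_le[OF c(2,1), of z N] psum_eq_trunc[OF c(2,1,3) assms(2)[of N] z] z
      by (simp add: power_divide)
    moreover have "(\<lambda>N. ?M * (norm z / r) ^ N) \<longlonglongrightarrow> ?M * 0"
      by (intro tendsto_mult_left LIMSEQ_power_zero) (use z c(1) in auto)
    ultimately have "norm (f z) \<le> ?M * 0"
      by (intro LIMSEQ_le_const) auto
    then show ?thesis by simp
  qed
  then show ?thesis using eventually_nhds_0_norm_less[OF c(1)] by (auto elim: eventually_mono)
qed

lemma real_analytic_leading:
  assumes "real_analytic_at f 0" "order_ge N f"
  obtains d where "order_ge (Suc N) (\<lambda>z. f z - hpoly N d z)"
proof -
  obtain c r where c: "0 < r" "majorized c r" "\<And>z. norm z < r \<Longrightarrow> f z = psum c (re_im z)"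
    by (rule real_analytic_psum[OF assms(1)]) (rule that)
  let ?P = "hpoly N (\<lambda>i. c (i, N - i))"
  have "psum (trunc (Suc N) c) (re_im z) = f z - ?P z" if "norm z < r" for z
    using psum_eq_trunc[OF c(2,1,3) assms(2) that] psum_trunc_step[OF c(2), of z N] that by simp
  then have "\<forall>\<^sub>F z in nhds 0. psum (trunc (Suc N) c) (re_im z) = f z - ?P z"
    using eventually_nhds_0_norm_less[OF c(1)] by (auto elim: eventually_mono)
  from order_ge_cong[OF psum_trunc_order_ge[OF c(2,1)] this] show ?thesis by (rule that)
qed

lemma real_analytic_order_ge_0:
  assumes "real_analytic_at f 0"
  shows "order_ge 0 f"
proof -
  obtain c r where c: "0 < r" "majorized c r" "\<And>z. norm z < r \<Longrightarrow> f z = psum c (re_im z)"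
    by (rule real_analytic_psum[OF assms(1)]) (rule that)
  then have "\<forall>\<^sub>F z in nhds 0. psum (trunc 0 c) (re_im z) = f z"
    using eventually_nhds_0_norm_less[OF c(1)] by (auto elim: eventually_mono simp: trunc_0)
  from order_ge_cong[OF psum_trunc_order_ge[OF c(2,1)] this] show ?thesis .
qed

lemma real_analytic_order_Suc:
  assumes "real_analytic_at f 0" "order_ge N f" "order_gt N f"
  shows "order_ge (Suc N) f"
proof -
  obtain d where d: "order_ge (Suc N) (\<lambda>z. f z - hpoly N d z)"
    by (rule real_analytic_leading[OF assms(1,2)]) (rule that)
  from order_gt_diff[OF assms(3) order_ge_imp_gt[OF this]]
  have "order_gt N (hpoly N d)" by simp
  then show ?thesis using d hpoly_eq_0_if_order_gt by simp
qed

lemma psum_re_im_has_derivative: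
  assumes "majorized c R" "0 < r" "r < R" "norm z < r"
  shows "((\<lambda>z. psum c (re_im z)) has_derivative
     (\<lambda>h. psum (dx_coeff c) (re_im z) * of_real (Re h) + psum (dy_coeff c) (re_im z) * of_real (Im h))) (at z)"
proof -
  have "re_im z \<in> ball 0 r \<times> ball 0 r"
    using le_less_trans[OF norm_re_im(1) assms(4)] le_less_trans[OF norm_re_im(2) assms(4)] by auto
  from psum_has_derivative[OF assms(1-3) this]
  have *: "(psum c has_derivative (\<lambda>h. psum (dx_coeff c) (re_im z) * fst h + psum (dy_coeff c) (re_im z) * snd h)) (at (re_im z))" .
  have "(re_im has_derivative re_im) (at z)" by (auto intro!: derivative_eq_intros)
  from has_derivative_compose[where g = "psum c", OF this *] show ?thesis by simp
qed

text \<open>A germ of order N + 1 equals its series truncated at N + 1, whose termwise derivatives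
  are truncated at N; uniqueness of derivatives identifies these with \<open>fx\<close> and
  \<open>fy\<close>. Hence the last clause.\<close>

lemma real_analytic_has_derivative:
  fixes f :: "complex \<Rightarrow> complex"
  assumes "real_analytic_at f 0"
  obtains fx fy where "real_analytic_at fx 0" "real_analytic_at fy 0"
    "\<forall>\<^sub>F z in nhds 0. (f has_derivative (\<lambda>h. fx z * of_real (Re h) + fy z * of_real (Im h))) (at z)"
    "\<And>N. order_ge (Suc N) f \<Longrightarrow> order_ge N fx \<and> order_ge N fy"
proof -
  obtain c R where c: "0 < R" "majorized c R" "\<And>z. norm z < R \<Longrightarrow> f z = psum c (re_im z)"
    by (rule real_analytic_psum[OF assms(1)]) (rule that)
  obtain r where r: "0 < r" "r < R" using dense c(1) by blast
  let ?fx = "\<lambda>c z. psum (dx_coeff c) (re_im z)" and ?fy = "\<lambda>c z. psum (dy_coeff c) (re_im z)"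
  have der: "(f has_derivative (\<lambda>h. ?fx c' z * of_real (Re h) + ?fy c' z * of_real (Im h))) (at z)"
    if "majorized c' R" "\<And>z. norm z < R \<Longrightarrow> f z = psum c' (re_im z)" "norm z < r" for z c'
    by (rule has_derivative_transform_within_open[OF psum_re_im_has_derivative[OF that(1) r that(3)] open_ball[of 0 r]])
       (use that r in auto)
  have ord: "order_ge N (?fx c) \<and> order_ge N (?fy c)" if "order_ge (Suc N) f" for N
  proof -
    let ?c' = "trunc (Suc N) c"
    have eq: "?fx c z = ?fx ?c' z \<and> ?fy c z = ?fy ?c' z" if "norm z < r" for z
    proof -
      have "(\<lambda>h. ?fx c z * of_real (Re h) + ?fy c z * of_real (Im h))
          = (\<lambda>h. ?fx ?c' z * of_real (Re h) + ?fy ?c' z * of_real (Im h))"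
        by (rule has_derivative_unique[OF der[OF c(2,3) that] der[of ?c']])
           (use that c majorized_trunc[OF c(2)] psum_eq_trunc[OF c(2,1,3) \<open>order_ge (Suc N) f\<close>] in auto)
      from fun_cong[OF this, of 1] fun_cong[OF this, of \<i>] show ?thesis by simp
    qed
    have "order_ge N (\<lambda>z. ?fx ?c' z)" "order_ge N (\<lambda>z. ?fy ?c' z)"
      unfolding dx_trunc dy_trunc
      by (rule psum_trunc_order_ge[OF majorized_dx[OF c(2) r] r(1)]
          psum_trunc_order_ge[OF majorized_dy[OF c(2) r] r(1)])+
    moreover have "\<forall>\<^sub>F z in nhds 0. ?fx ?c' z = ?fx c z" "\<forall>\<^sub>F z in nhds 0. ?fy ?c' z = ?fy c z"
      using eventually_nhds_0_norm_less[OF r(1)] by (auto elim!: eventually_mono dest: eq)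
    ultimately show ?thesis by (blast intro: order_ge_cong[of N "?fx ?c'" "?fx c"] order_ge_cong[of N "?fy ?c'" "?fy c"])
  qed
  show ?thesis
  proof (rule that[of "?fx c" "?fy c"])
    show "real_analytic_at (?fx c) 0"
      by (rule psum_imp_real_analytic[OF r(1) majorized_dx[OF c(2) r]]) simp
    show "real_analytic_at (?fy c) 0"
      by (rule psum_imp_real_analytic[OF r(1) majorized_dy[OF c(2) r]]) simp
    show "\<forall>\<^sub>F z in nhds 0. (f has_derivative (\<lambda>h. ?fx c z * of_real (Re h) + ?fy c z * of_real (Im h))) (at z)"
      using eventually_nhds_0_norm_less[OF r(1)] by eventually_elim (rule der[OF c(2,3)])
  qed (use ord in auto)
qed

text \<open>Mean value inequality on the disc of radius \<rho>, where the differential is O(\<rho> ^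
  N). The factor |u - v| keeps information that separate bounds for f u and f v would lose.\<close>

lemma real_analytic_lipschitz:
  fixes f :: "complex \<Rightarrow> complex"
  assumes "real_analytic_at f 0" "order_ge (Suc N) f"
  obtains C r where "0 < C" "0 < r"
    "\<And>\<rho> u v. \<rho> < r \<Longrightarrow> norm u \<le> \<rho> \<Longrightarrow> norm v \<le> \<rho> \<Longrightarrow> norm (f u - f v) \<le> C * \<rho> ^ N * norm (u - v)"
proof -
  obtain fx fy where fxy: "\<forall>\<^sub>F z in nhds 0. (f has_derivative (\<lambda>h. fx z * of_real (Re h) + fy z * of_real (Im h))) (at z)"
    and ord: "\<And>N. order_ge (Suc N) f \<Longrightarrow> order_ge N fx \<and> order_ge N fy"
    by (rule real_analytic_has_derivative[OF assms(1)]) (rule that)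
  obtain s where s: "0 < s" "\<And>z. norm z < s \<Longrightarrow> (f has_derivative (\<lambda>h. fx z * of_real (Re h) + fy z * of_real (Im h))) (at z)"
    using fxy unfolding eventually_nhds_metric by auto
  obtain C1 r1 where 1: "0 < C1" "0 < r1" "\<And>z. norm z < r1 \<Longrightarrow> norm (fx z) \<le> C1 * norm z ^ N"
    by (rule order_geE[OF conjunct1[OF ord[OF assms(2)]]]) (rule that)
  obtain C2 r2 where 2: "0 < C2" "0 < r2" "\<And>z. norm z < r2 \<Longrightarrow> norm (fy z) \<le> C2 * norm z ^ N"
    by (rule order_geE[OF conjunct2[OF ord[OF assms(2)]]]) (rule that)
  show ?thesis
  proof (rule that[of "C1 + C2" "min s (min r1 r2)"])
    fix \<rho> :: real and u v :: complex assume \<rho>: "\<rho> < min s (min r1 r2)" and uv: "norm u \<le> \<rho>" "norm v \<le> \<rho>"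
    have "norm (f u - f v) \<le> ((C1 + C2) * \<rho> ^ N) * norm (u - v)"
    proof (rule differentiable_bound[of "cball 0 \<rho>"])
      fix x :: complex assume "x \<in> cball 0 \<rho>"
      then have x: "norm x \<le> \<rho>" by simp
      show "(f has_derivative (\<lambda>h. fx x * of_real (Re h) + fy x * of_real (Im h))) (at x within cball 0 \<rho>)"
        by (rule has_derivative_at_withinI[OF s(2)]) (use x \<rho> in auto)
      show "onorm (\<lambda>h. fx x * of_real (Re h) + fy x * of_real (Im h)) \<le> (C1 + C2) * \<rho> ^ N"
      proof (rule onorm_le)
        fix h
        have pw: "norm x ^ N \<le> \<rho> ^ N" using x by (simp add: power_mono)
        have "norm (fx x) \<le> C1 * \<rho> ^ N" "norm (fy x) \<le> C2 * \<rho> ^ N"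
          using order_trans[OF 1(3) mult_left_mono[OF pw]] order_trans[OF 2(3) mult_left_mono[OF pw]] x \<rho> 1(1) 2(1) by auto
        then have "norm (fx x) * \<bar>Re h\<bar> + norm (fy x) * \<bar>Im h\<bar> \<le> C1 * \<rho> ^ N * norm h + C2 * \<rho> ^ N * norm h"
          by (intro add_mono mult_mono abs_Re_le_cmod abs_Im_le_cmod) (auto intro: order_trans[OF norm_ge_zero])
        then show "norm (fx x * of_real (Re h) + fy x * of_real (Im h)) \<le> (C1 + C2) * \<rho> ^ N * norm h"
          by (intro order_trans[OF norm_triangle_ineq]) (simp add: norm_mult algebra_simps)
      qed
    qed (use uv in auto)
    then show "norm (f u - f v) \<le> (C1 + C2) * \<rho> ^ N * norm (u - v)" .
  qed (use s 1 2 in auto)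
qed

subsection \<open>Local inverses\<close>

lemma real_analytic_isCont:
  assumes "real_analytic_at (f :: complex \<Rightarrow> complex) 0"
  shows "isCont f 0"
proof -
  obtain fx fy where "\<forall>\<^sub>F z in nhds 0. (f has_derivative (\<lambda>h. fx z * of_real (Re h) + fy z * of_real (Im h))) (at z)"
    by (rule real_analytic_has_derivative[OF assms]) (rule that)
  from has_derivative_continuous[OF eventually_nhds_x_imp_x[OF this]] show ?thesis .
qed

lemma real_analytic_eventually_compose:
  assumes "real_analytic_at (f :: complex \<Rightarrow> complex) 0" "f 0 = 0" "\<forall>\<^sub>F z in nhds 0. P z"
  shows "\<forall>\<^sub>F z in nhds 0. P (f z)"
proof -
  have "(f \<longlongrightarrow> 0) (nhds 0)"
    using real_analytic_isCont[OF assms(1)] assms(2) tendsto_at_iff_tendsto_nhds[of f 0] by (simp add: isCont_def)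
  with assms(3) show ?thesis by (rule eventually_compose_filterlim)
qed

text \<open>Used in \<open>real_analytic_inverse\<close> to show that the inverse map of C x C sends
  real points near 0 to real points.\<close>

lemma psum_cnj:
  "psum (\<lambda>k. complex_of_real (a k)) (cnj (fst p), cnj (snd p)) = cnj (psum (\<lambda>k. complex_of_real (a k)) p)"
  unfolding psum_def by (simp flip: infsum_cnj)

lemma psum_coeffs_at_0:
  assumes c: "majorized c r" "0 < r" "\<And>z. norm z < r \<Longrightarrow> u z = psum c (re_im z)"
    and u: "(u has_derivative u') (at 0)"
  shows "psum (dx_coeff c) 0 = u' 1" "psum (dy_coeff c) 0 = u' \<i>"
proof -
  obtain s where s: "0 < s" "s < r" using dense c(2) by blast
  have "((\<lambda>z. psum c (re_im z)) has_derivative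
      (\<lambda>h. psum (dx_coeff c) (re_im 0) * of_real (Re h) + psum (dy_coeff c) (re_im 0) * of_real (Im h))) (at 0)"
    by (rule psum_re_im_has_derivative[OF c(1) s]) (use s in simp)
  then have "(u has_derivative
      (\<lambda>h. psum (dx_coeff c) (re_im 0) * of_real (Re h) + psum (dy_coeff c) (re_im 0) * of_real (Im h))) (at 0)"
    by (rule has_derivative_transform_within_open[of _ _ _ _ "ball 0 r"]) (use c in auto)
  from has_derivative_unique[OF this u]
  have "(\<lambda>h. psum (dx_coeff c) 0 * of_real (Re h) + psum (dy_coeff c) 0 * of_real (Im h)) = u'"
    by (simp add: zero_prod_def)
  from fun_cong[OF this, of 1] fun_cong[OF this, of \<i>]
  show "psum (dx_coeff c) 0 = u' 1" "psum (dy_coeff c) 0 = u' \<i>" by simp_all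
qed

text \<open>Cramer's rule. The inverse function theorem delivers the derivative of the inverse as an
  abstract \<open>inv\<close>; explicit entries show that it is complex linear with continuous
  coefficients.\<close>

lemma bij_matrix2_inverse:
  fixes a b c d :: complex
  assumes "bij (\<lambda>h. (a * fst h + b * snd h, c * fst h + d * snd h))" (is "bij ?f")
  shows "a * d - b * c \<noteq> 0"
    and "inv ?f = (\<lambda>k. (d / (a * d - b * c) * fst k + (- b / (a * d - b * c)) * snd k,
          (- c / (a * d - b * c)) * fst k + a / (a * d - b * c) * snd k))"
proof -
  have inj: "inj ?f" using assms by (rule bij_is_inj)
  have ker: "h = 0" if "?f h = 0" for h
    using injD[OF inj, of h 0] that by (simp add: zero_prod_def)
  show det: "a * d - b * c \<noteq> 0"
  proof
    assume 0: "a * d - b * c = 0"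
    \<comment> \<open>With determinant 0 both vectors lie in the kernel, so injectivity makes all
      entries 0 and the map itself zero.\<close>
    have "(-b, a) = 0" by (rule ker) (use 0 in \<open>simp add: zero_prod_def algebra_simps\<close>)
    moreover have "(d, -c) = 0" by (rule ker) (use 0 in \<open>simp add: zero_prod_def algebra_simps\<close>)
    ultimately have "?f (1, 0) = 0" by (simp add: zero_prod_def)
    from ker[OF this] show False by (simp add: zero_prod_def)
  qed
  let ?D = "a * d - b * c"
  have "inv ?f k = (d / ?D * fst k + (- b / ?D) * snd k, (- c / ?D) * fst k + a / ?D * snd k)" for k
  proof (rule inv_f_eq[OF inj])
    have "a * (d / ?D * x + (- b / ?D) * y) + b * ((- c / ?D) * x + a / ?D * y) = ?D / ?D * x"
         "c * (d / ?D * x + (- b / ?D) * y) + d * ((- c / ?D) * x + a / ?D * y) = ?D / ?D * y" for x y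
      by (simp_all only: diff_divide_distrib minus_divide_left[symmetric]) (simp_all add: algebra_simps)
    then show "?f (d / ?D * fst k + (- b / ?D) * snd k, (- c / ?D) * fst k + a / ?D * snd k) = k"
      using det by simp
  qed
  then show "inv ?f = (\<lambda>k. (d / ?D * fst k + (- b / ?D) * snd k, (- c / ?D) * fst k + a / ?D * snd k))"
    by (rule ext)
qed

text \<open>The derivative at 0 is the identity, so the left inverse demanded by the inverse
  function theorem is \<open>id_blinfun\<close>. The left inverse laws record uniqueness of
  preimages in U, on which the reality argument later rests.\<close>

lemma hol2_inverse:
  fixes F1 F2 A1 B1 A2 B2 :: "complex \<times> complex \<Rightarrow> complex"
  assumes S: "open S" "0 \<in> S" and F0: "F1 0 = 0" "F2 0 = 0"
    and cont: "continuous_on S A1" "continuous_on S B1" "continuous_on S A2" "continuous_on S B2"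
    and F1: "\<And>p. p \<in> S \<Longrightarrow> (F1 has_derivative (\<lambda>h. A1 p * fst h + B1 p * snd h)) (at p)"
    and F2: "\<And>p. p \<in> S \<Longrightarrow> (F2 has_derivative (\<lambda>h. A2 p * fst h + B2 p * snd h)) (at p)"
    and id0: "A1 0 = 1" "B1 0 = 0" "A2 0 = 0" "B2 0 = 1"
  obtains U V G1 G2 where "open U" "0 \<in> U" "U \<subseteq> S" "open V" "0 \<in> V" "hol2 G1 V" "hol2 G2 V"
    "\<And>p. p \<in> U \<Longrightarrow> G1 (F1 p, F2 p) = fst p" "\<And>p. p \<in> U \<Longrightarrow> G2 (F1 p, F2 p) = snd p"
    "\<And>y. y \<in> V \<Longrightarrow> (G1 y, G2 y) \<in> U"
    "\<And>y. y \<in> V \<Longrightarrow> F1 (G1 y, G2 y) = fst y" "\<And>y. y \<in> V \<Longrightarrow> F2 (G1 y, G2 y) = snd y"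
proof -
  define L where "L p = (\<lambda>h. (A1 p * fst h + B1 p * snd h, A2 p * fst h + B2 p * snd h))" for p
  define \<Psi> where "\<Psi> p = (F1 p, F2 p)" for p
  have bl: "bounded_linear (L p)" for p
    unfolding L_def by (intro bounded_linear_Pair bounded_linear_add
        bounded_linear_const_mult bounded_linear_fst bounded_linear_snd)
  have app: "blinfun_apply (Blinfun (L p)) = L p" for p
    by (rule bounded_linear_Blinfun_apply[OF bl])
  have der: "(\<Psi> has_derivative blinfun_apply (Blinfun (L p))) (at p)" if "p \<in> S" for p
    unfolding app unfolding L_def \<Psi>_def[abs_def]
    by (rule has_derivative_Pair[OF F1[OF that] F2[OF that]])
  have contL: "continuous_on S (\<lambda>p. Blinfun (L p))"
    by (rule continuous_on_blinfun_componentwise)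
       (unfold app, unfold L_def, intro continuous_intros cont)
  have inv0: "id_blinfun o\<^sub>L Blinfun (L 0) = id_blinfun"
    by (rule blinfun_eqI) (simp add: app, simp add: L_def id0)
  obtain U V g g' where g: "open U" "U \<subseteq> S" "0 \<in> U" "open V" "\<Psi> 0 \<in> V" "homeomorphism U V \<Psi> g"
    "\<And>y. y \<in> V \<Longrightarrow> (g has_derivative (g' y)) (at y)"
    "\<And>y. y \<in> V \<Longrightarrow> g' y = inv (blinfun_apply (Blinfun (L (g y))))"
    "\<And>y. y \<in> V \<Longrightarrow> bij (blinfun_apply (Blinfun (L (g y))))"
    by (rule inverse_function_theorem[OF S(1) der contL S(2) inv0]) (assumption | rule that)+
  have gV: "g y \<in> U" if "y \<in> V" for y using g(6) that unfolding homeomorphism_def by blast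
  have gcont: "continuous_on V g" using g(6) unfolding homeomorphism_def by blast
  define \<Delta> where "\<Delta> p = A1 p * B2 p - B1 p * A2 p" for p
  have g_der: "\<Delta> (g y) \<noteq> 0" "(g has_derivative (\<lambda>k. (B2 (g y) / \<Delta> (g y) * fst k + (- B1 (g y) / \<Delta> (g y)) * snd k,
          (- A2 (g y) / \<Delta> (g y)) * fst k + A1 (g y) / \<Delta> (g y) * snd k))) (at y)" if y: "y \<in> V" for y
  proof -
    have bij: "bij (\<lambda>h. (A1 (g y) * fst h + B1 (g y) * snd h, A2 (g y) * fst h + B2 (g y) * snd h))"
      using g(9)[OF y] unfolding app unfolding L_def .
    show "\<Delta> (g y) \<noteq> 0" unfolding \<Delta>_def by (rule bij_matrix2_inverse(1)[OF bij])
    show "(g has_derivative (\<lambda>k. (B2 (g y) / \<Delta> (g y) * fst k + (- B1 (g y) / \<Delta> (g y)) * snd k,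
          (- A2 (g y) / \<Delta> (g y)) * fst k + A1 (g y) / \<Delta> (g y) * snd k))) (at y)"
      using g(7)[OF y] unfolding g(8)[OF y] app unfolding L_def bij_matrix2_inverse(2)[OF bij] \<Delta>_def .
  qed
  have c: "continuous_on V (\<lambda>y. A1 (g y))" "continuous_on V (\<lambda>y. B1 (g y))"
      "continuous_on V (\<lambda>y. A2 (g y))" "continuous_on V (\<lambda>y. B2 (g y))"
    by (rule continuous_on_compose2[OF cont(1) gcont] continuous_on_compose2[OF cont(2) gcont]
         continuous_on_compose2[OF cont(3) gcont] continuous_on_compose2[OF cont(4) gcont]; use gV g(2) in auto)+
  then have c\<Delta>: "continuous_on V (\<lambda>y. \<Delta> (g y))" unfolding \<Delta>_def by (intro continuous_intros)
  have "hol2 (\<lambda>y. fst (g y)) V"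
    by (rule hol2I[of V "\<lambda>y. B2 (g y) / \<Delta> (g y)" "\<lambda>y. - B1 (g y) / \<Delta> (g y)"])
       (intro continuous_intros c c\<Delta> ballI g_der(1), assumption,
        intro continuous_intros c c\<Delta> ballI g_der(1), assumption,
        use has_derivative_fst[OF g_der(2)] in simp)
  moreover have "hol2 (\<lambda>y. snd (g y)) V"
    by (rule hol2I[of V "\<lambda>y. - A2 (g y) / \<Delta> (g y)" "\<lambda>y. A1 (g y) / \<Delta> (g y)"])
       (intro continuous_intros c c\<Delta> ballI g_der(1), assumption,
        intro continuous_intros c c\<Delta> ballI g_der(1), assumption,
        use has_derivative_snd[OF g_der(2)] in simp)
  moreover have "g (F1 p, F2 p) = p" if "p \<in> U" for p
    using homeomorphism_apply1[OF g(6) that] by (simp add: \<Psi>_def)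
  moreover have "(F1 (g y), F2 (g y)) = y" if "y \<in> V" for y
    using homeomorphism_apply2[OF g(6) that] by (simp add: \<Psi>_def)
  moreover have "0 \<in> V" using g(5) F0 by (simp add: \<Psi>_def zero_prod_def)
  ultimately show ?thesis
    using g(1-4) gV by (intro that[of U V "\<lambda>y. fst (g y)" "\<lambda>y. snd (g y)"]) (auto simp: prod_eq_iff)
qed

text \<open>Re \<psi> and Im \<psi> extend to holomorphic functions with real coefficients, and the
  extended map is inverted in C x C. Over a real point the conjugate of the preimage is again a
  preimage; injectivity makes the two equal, so the inverse restricts to the real plane.\<close>

lemma real_analytic_inverse:
  fixes \<psi> :: "complex \<Rightarrow> complex"
  assumes "real_analytic_at \<psi> 0" "\<psi> 0 = 0" "(\<psi> has_derivative (\<lambda>h. h)) (at 0)"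
  obtains \<phi> where "analytic_diffeo_germ \<phi> \<psi>"
proof -
  obtain a1 r1 where 1: "0 < r1" "majorized (\<lambda>k. complex_of_real (a1 k)) r1"
    "\<And>z. norm z < r1 \<Longrightarrow> complex_of_real (Re (\<psi> z)) = psum (\<lambda>k. complex_of_real (a1 k)) (re_im z)"
    by (rule real_analytic_imp_psum_gen[OF real_analytic_bounded_linear[OF assms(1) bounded_linear_Re] bounded_linear_of_real])
       (rule that)
  obtain a2 r2 where 2: "0 < r2" "majorized (\<lambda>k. complex_of_real (a2 k)) r2"
    "\<And>z. norm z < r2 \<Longrightarrow> complex_of_real (Im (\<psi> z)) = psum (\<lambda>k. complex_of_real (a2 k)) (re_im z)"
    by (rule real_analytic_imp_psum_gen[OF real_analytic_bounded_linear[OF assms(1) bounded_linear_Im] bounded_linear_of_real])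
       (rule that)
  define c1 where "c1 = (\<lambda>k. complex_of_real (a1 k))"
  define c2 where "c2 = (\<lambda>k. complex_of_real (a2 k))"
  define R where "R = min r1 r2"
  have R: "0 < R" using 1 2 by (simp add: R_def)
  have c1: "majorized c1 R" "\<And>z. norm z < R \<Longrightarrow> complex_of_real (Re (\<psi> z)) = psum c1 (re_im z)"
    using 1 2 majorized_mono[OF 1(2), of R] by (auto simp: c1_def R_def)
  have c2: "majorized c2 R" "\<And>z. norm z < R \<Longrightarrow> complex_of_real (Im (\<psi> z)) = psum c2 (re_im z)"
    using 1 2 majorized_mono[OF 2(2), of R] by (auto simp: c2_def R_def)
  obtain r where r: "0 < r" "r < R" using dense R by blast
  obtain s where s: "r < s" "s < R" using dense r by blast
  have s0: "0 < s" using r s by simp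
  let ?S = "ball 0 r \<times> ball 0 r :: (complex \<times> complex) set"
  have d0: "((\<lambda>z. complex_of_real (Re (\<psi> z))) has_derivative (\<lambda>h. complex_of_real (Re h))) (at 0)"
       "((\<lambda>z. complex_of_real (Im (\<psi> z))) has_derivative (\<lambda>h. complex_of_real (Im h))) (at 0)"
    using assms(3) by (auto intro!: derivative_eq_intros)
  have psum0: "psum c1 0 = 0" "psum c2 0 = 0"
    using c1(2)[of 0] c2(2)[of 0] R assms(2) by (auto simp: zero_prod_def)
  obtain U V G1 G2 where UV: "open U" "0 \<in> U" "U \<subseteq> ?S" "open V" "0 \<in> V" "hol2 G1 V" "hol2 G2 V"
    and G_left: "\<And>p. p \<in> U \<Longrightarrow> G1 (psum c1 p, psum c2 p) = fst p" "\<And>p. p \<in> U \<Longrightarrow> G2 (psum c1 p, psum c2 p) = snd p"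
    and GU: "\<And>y. y \<in> V \<Longrightarrow> (G1 y, G2 y) \<in> U"
    and G_right: "\<And>y. y \<in> V \<Longrightarrow> psum c1 (G1 y, G2 y) = fst y" "\<And>y. y \<in> V \<Longrightarrow> psum c2 (G1 y, G2 y) = snd y"
  proof (rule hol2_inverse[where S = ?S and ?F1.0 = "psum c1" and ?F2.0 = "psum c2"
      and ?A1.0 = "psum (dx_coeff c1)" and ?B1.0 = "psum (dy_coeff c1)"
      and ?A2.0 = "psum (dx_coeff c2)" and ?B2.0 = "psum (dy_coeff c2)"])
    show "0 \<in> ?S" using r by (simp add: zero_prod_def)
    show "continuous_on ?S (psum (dx_coeff c1))" "continuous_on ?S (psum (dy_coeff c1))"
         "continuous_on ?S (psum (dx_coeff c2))" "continuous_on ?S (psum (dy_coeff c2))"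
      by (rule psum_continuous_on[OF majorized_dx[OF c1(1) s0 s(2)] r(1) s(1)]
        psum_continuous_on[OF majorized_dy[OF c1(1) s0 s(2)] r(1) s(1)]
        psum_continuous_on[OF majorized_dx[OF c2(1) s0 s(2)] r(1) s(1)]
        psum_continuous_on[OF majorized_dy[OF c2(1) s0 s(2)] r(1) s(1)])+
    show "psum (dx_coeff c1) 0 = 1" "psum (dy_coeff c1) 0 = 0"
      using psum_coeffs_at_0[OF c1(1) R c1(2) d0(1)] by simp_all
    show "psum (dx_coeff c2) 0 = 0" "psum (dy_coeff c2) 0 = 1"
      using psum_coeffs_at_0[OF c2(1) R c2(2) d0(2)] by simp_all
  qed (use open_polydisc psum0 psum_has_derivative[OF c1(1) r] psum_has_derivative[OF c2(1) r] in \<open>auto intro: that\<close>)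
  \<comment> \<open>Taking real parts gives a total map of the plane; near 0 nothing is discarded,
    since the values prove to be real.\<close>
  define \<phi> where "\<phi> z = Complex (Re (G1 (re_im z))) (Re (G2 (re_im z)))" for z
  have G0: "G1 0 = 0" "G2 0 = 0" using G_left[OF UV(2)] psum0 by (auto simp: zero_prod_def)
  have \<phi>0: "\<phi> 0 = 0" using G0 by (simp add: \<phi>_def zero_prod_def complex_eq_iff)
  have anG: "real_analytic_at (\<lambda>z. G1 (re_im z)) 0" "real_analytic_at (\<lambda>z. G2 (re_im z)) 0"
    by (rule hol2_imp_real_analytic[OF UV(6,4,5)], simp, rule hol2_imp_real_analytic[OF UV(7,4,5)], simp)
  have \<phi>_eq: "\<phi> = (\<lambda>z. complex_of_real (Re (G1 (re_im z))) + \<i> * complex_of_real (Re (G2 (re_im z))))"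
    by (simp add: \<phi>_def fun_eq_iff complex_eq_iff)
  have an\<phi>: "real_analytic_at \<phi> 0"
    unfolding \<phi>_eq
    by (intro real_analytic_add real_analytic_mult real_analytic_const real_analytic_of_real
        real_analytic_bounded_linear[OF _ bounded_linear_Re] anG)
  have re_im_nhds: "\<forall>\<^sub>F z in nhds 0. re_im z \<in> W" if "open W" "0 \<in> W" for W
  proof -
    have "isCont re_im 0"
      by (intro continuous_intros linear_continuous_at bounded_linear_Re bounded_linear_Im)
    then have "(re_im \<longlongrightarrow> 0) (nhds 0)"
      using tendsto_at_iff_tendsto_nhds[of re_im 0] by (simp add: isCont_def zero_prod_def)
    from topological_tendstoD[OF this that] show ?thesis .
  qed
  \<comment> \<open>Injectivity is available on U, so the conjugate preimage must lie in U as well;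
    this open condition holds at 0.\<close>
  let ?q = "\<lambda>y. (cnj (G1 y), cnj (G2 y))"
  have "continuous_on V ?q"
    by (intro continuous_intros hol2_continuous_on UV(6,7))
  then have openW: "open (V \<inter> ?q -` U)" by (intro continuous_open_preimage UV)
  have "0 \<in> V \<inter> ?q -` U" using UV G0 by (simp add: zero_prod_def)
  from re_im_nhds[OF openW this]
  have real: "\<forall>\<^sub>F z in nhds 0. re_im z \<in> V \<and> (G1 (re_im z), G2 (re_im z)) = re_im (\<phi> z)"
  proof eventually_elim
    case (elim z)
    let ?y = "re_im z"
    have q: "?q ?y \<in> U" "?y \<in> V" using elim by auto
    have "psum c1 (?q ?y) = fst ?y" "psum c2 (?q ?y) = snd ?y"
      using psum_cnj[of a1 "(G1 ?y, G2 ?y)"] psum_cnj[of a2 "(G1 ?y, G2 ?y)"] G_right[OF q(2)]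
      by (simp_all add: c1_def c2_def)
    then have "cnj (G1 ?y) = G1 ?y" "cnj (G2 ?y) = G2 ?y"
      using G_left[OF q(1)] by simp_all
    then show ?case using q(2) by (simp add: \<phi>_def complex_eq_iff)
  qed
  have "\<forall>\<^sub>F z in nhds 0. norm (\<phi> z) < R"
    by (rule real_analytic_eventually_compose[OF an\<phi> \<phi>0 eventually_nhds_0_norm_less[OF R]])
  with real have "\<forall>\<^sub>F z in nhds 0. \<psi> (\<phi> z) = z"
  proof eventually_elim
    case (elim z)
    have "psum c1 (re_im (\<phi> z)) = Re z" "psum c2 (re_im (\<phi> z)) = Im z"
      using elim(1) G_right[of "re_im z"] by auto
    with c1(2)[OF elim(2)] c2(2)[OF elim(2)] show ?case by (simp add: complex_eq_iff)
  qed
  moreover have "\<forall>\<^sub>F z in nhds 0. \<phi> (\<psi> z) = z"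
    using re_im_nhds[OF UV(1,2)] eventually_nhds_0_norm_less[OF R]
  proof eventually_elim
    case (elim z)
    have "re_im (\<psi> z) = (psum c1 (re_im z), psum c2 (re_im z))"
      using c1(2)[OF elim(2)] c2(2)[OF elim(2)] by simp
    then show ?case unfolding \<phi>_def by (simp only: G_left[OF elim(1)] fst_conv snd_conv Re_complex_of_real complex_surj)
  qed
  ultimately show ?thesis
    using that assms an\<phi> \<phi>0 unfolding analytic_diffeo_germ_def by blast
qed

subsection \<open>Leading forms of first integrals\<close>

text \<open>The differential of \<open>hpoly n d\<close> at z in the direction h, as an explicit sum
  so that continuity in z and homogeneity in h can be read off.\<close>

definition dhpoly :: "nat \<Rightarrow> (nat \<Rightarrow> complex) \<Rightarrow> complex \<Rightarrow> complex \<Rightarrow> complex" where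
  "dhpoly n d z h = (\<Sum>i\<le>n. d i * (of_nat i * of_real (Re z) ^ (i - 1) * of_real (Re h) * of_real (Im z) ^ (n - i)
      + of_real (Re z) ^ i * (of_nat (n - i) * of_real (Im z) ^ (n - i - 1) * of_real (Im h))))"

lemma hpoly_has_derivative: "(hpoly n d has_derivative dhpoly n d z) (at z)"
proof -
  have "((\<lambda>z. \<Sum>i\<le>n. d i * of_real (Re z) ^ i * of_real (Im z) ^ (n - i)) has_derivative
     (\<lambda>h. \<Sum>i\<le>n. d i * (of_nat i * of_real (Re z) ^ (i - 1) * of_real (Re h) * of_real (Im z) ^ (n - i)
      + of_real (Re z) ^ i * (of_nat (n - i) * of_real (Im z) ^ (n - i - 1) * of_real (Im h))))) (at z)"
    by (intro has_derivative_sum) (auto intro!: derivative_eq_intros simp: algebra_simps)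
  then show ?thesis by (simp add: hpoly_def[abs_def] dhpoly_def[abs_def])
qed

lemma dhpoly_scaleR: "dhpoly n d z (of_real t * h) = of_real t * dhpoly n d z h"
  unfolding dhpoly_def sum_distrib_left by (intro sum.cong) (auto simp: algebra_simps)

lemma isCont_hpoly: "isCont (hpoly n d) z"
  by (rule has_derivative_continuous[OF hpoly_has_derivative])

text \<open>Blow-up at scale t. With v t = h (t z) / t ^ k, which tends to the leading form H of h
  at z, the point t z moves to t (z + t ^ (k - 1) v t). Invariance of K turns the increment of its
  leading form J into that of the remainder, smaller by a factor t; dividing by t ^ (m + k - 1) and
  letting t tend to 0 leaves the derivative of J along H z.\<close>

lemma leading_term_orthogonal:
  assumes K: "real_analytic_at K 0" and inv: "\<forall>\<^sub>F z in nhds 0. K (z + h z) = K z"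
    and Kd: "order_ge (Suc m) (\<lambda>z. K z - hpoly m d z)"
    and he: "order_ge (Suc k) (\<lambda>z. h z - hpoly k e z)" and k: "2 \<le> k"
  shows "dhpoly m d z (hpoly k e z) = 0"
proof -
  let ?J = "hpoly m d" and ?H = "hpoly k e z"
  let ?E = "\<lambda>z. K z - ?J z"
  let ?D = "dhpoly m d z"
  have E: "real_analytic_at ?E 0" by (intro real_analytic_diff K real_analytic_hpoly)
  obtain C r where C: "0 < C" "0 < r"
    "\<And>\<rho> u v. \<rho> < r \<Longrightarrow> norm u \<le> \<rho> \<Longrightarrow> norm v \<le> \<rho> \<Longrightarrow> norm (?E u - ?E v) \<le> C * \<rho> ^ m * norm (u - v)"
    by (rule real_analytic_lipschitz[OF E Kd]) (rule that)
  obtain B s where B: "0 < B" "0 < s" "\<And>z. norm z < s \<Longrightarrow> norm (h z - hpoly k e z) \<le> B * norm z ^ Suc k"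
    by (rule order_geE[OF he]) (rule that)
  obtain s' where s': "0 < s'" "\<And>z. norm z < s' \<Longrightarrow> K (z + h z) = K z"
    using inv unfolding eventually_nhds_metric by auto
  define v where "v t = h (of_real t * z) / of_real t ^ k" for t
  \<comment> \<open>Once t ^ (k - 1) |v t| < 1, both compared points have norm at most t
    \<open>?M\<close>.\<close>
  let ?M = "norm z + 1"
  have M: "0 < ?M" "norm z < ?M" by (auto intro: add_nonneg_pos)
  have small: "\<forall>\<^sub>F t in at_right 0. t * ?M < a" if "0 < a" for a :: real
  proof -
    have "((\<lambda>t. t * ?M) \<longlongrightarrow> 0 * ?M) (at_right 0)" by (intro tendsto_intros)
    then show ?thesis using order_tendstoD(2) that by fastforce
  qed
  have pos: "\<forall>\<^sub>F t in at_right 0. (0::real) < t" by (simp add: eventually_at_filter)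
  have v_lim: "(v \<longlongrightarrow> ?H) (at_right 0)"
  proof (rule LIM_zero_cancel, rule Lim_null_comparison)
    show "\<forall>\<^sub>F t in at_right 0. norm (v t - ?H) \<le> B * norm z ^ Suc k * t"
      using small[OF B(2)] pos
    proof eventually_elim
      case (elim t)
      have "t * norm z \<le> t * ?M" using elim M by (intro mult_left_mono) auto
      then have "norm (of_real t * z) < s" using le_less_trans[OF _ elim(1)] elim(2) by (simp add: norm_mult)
      from B(3)[OF this] have "norm (h (of_real t * z) - of_real t ^ k * ?H) \<le> t ^ k * (B * norm z ^ Suc k * t)"
        using elim unfolding hpoly_scale by (simp add: norm_mult power_mult_distrib mult_ac)
      moreover have "h (of_real t * z) - of_real t ^ k * ?H = of_real t ^ k * (v t - ?H)"
        using elim by (simp add: v_def right_diff_distrib)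
      ultimately have "t ^ k * norm (v t - ?H) \<le> t ^ k * (B * norm z ^ Suc k * t)"
        using elim by (simp add: norm_mult norm_power)
      then show ?case by (rule mult_left_le_imp_le) (use elim in simp)
    qed
    have "((\<lambda>t. B * norm z ^ Suc k * t) \<longlongrightarrow> B * norm z ^ Suc k * 0) (at_right 0)" by (intro tendsto_intros)
    then show "((\<lambda>t. B * norm z ^ Suc k * t) \<longlongrightarrow> 0) (at_right 0)" by simp
  qed
  interpret D: bounded_linear ?D by (rule has_derivative_bounded_linear[OF hpoly_has_derivative])
  have k1: "Suc (k - 1) = k" "k - 1 \<noteq> 0" using k by auto
  have bound: "norm (?D ?H) \<le> \<epsilon> * norm ?H" if \<epsilon>: "0 < \<epsilon>" for \<epsilon>
  proof -
    obtain \<delta> where \<delta>: "0 < \<delta>" "\<And>y. norm (y - z) < \<delta> \<Longrightarrow> norm (?J y - ?J z - ?D (y - z)) \<le> \<epsilon> * norm (y - z)"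
      using hpoly_has_derivative[of m d z] \<epsilon> unfolding has_derivative_at_alt by meson
    \<comment> \<open>Here k >= 2 enters: with a positive exponent k - 1 the displacement tends to
      0, so differentiability of J at the fixed point z applies.\<close>
    have tk: "((\<lambda>t. t ^ (k - 1) * norm (v t)) \<longlongrightarrow> 0 ^ (k - 1) * norm ?H) (at_right 0)"
      by (intro tendsto_intros v_lim)
    then have "((\<lambda>t. t ^ (k - 1) * norm (v t)) \<longlongrightarrow> 0) (at_right 0)" using k1 by (simp add: power_0_left)
    from order_tendstoD(2)[OF this, of "min \<delta> 1"]
    have tk_small: "\<forall>\<^sub>F t in at_right 0. t ^ (k - 1) * norm (v t) < min \<delta> 1" using \<delta> by simp
    have "\<forall>\<^sub>F t in at_right 0. norm (?D (v t)) \<le> C * ?M ^ m * t * norm (v t) + \<epsilon> * norm (v t)"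
      using tk_small pos small[OF C(2)] small[OF s'(1)]
    proof eventually_elim
      case (elim t)
      let ?w = "of_real (t ^ (k - 1)) * v t"
      have t: "0 < t" using elim by simp
      have htz: "h (of_real t * z) = of_real t * ?w"
      proof -
        have "h (of_real t * z) = of_real t ^ Suc (k - 1) * v t" using t unfolding k1(1) by (simp add: v_def)
        then show ?thesis by (simp only: power_Suc of_real_power mult.assoc)
      qed
      have w: "norm ?w = t ^ (k - 1) * norm (v t)" using t by (simp add: norm_mult norm_power)
      have tz: "t * norm z \<le> t * ?M" using t M by (intro mult_left_mono) auto
      let ?u = "of_real t * z + h (of_real t * z)"
      have u: "?u = of_real t * (z + ?w)" unfolding htz by (simp only: distrib_left)
      have nu: "norm ?u \<le> t * ?M"
        unfolding u norm_mult using t elim(1) w norm_triangle_ineq[of z ?w] by (simp add: mult_left_mono)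
      have "norm (?E ?u - ?E (of_real t * z)) \<le> C * (t * ?M) ^ m * norm (?u - of_real t * z)"
        by (rule C(3)) (use elim nu tz t in \<open>simp_all add: norm_mult\<close>)
      moreover have "K ?u = K (of_real t * z)"
        by (rule s'(2)) (use le_less_trans[OF tz elim(4)] t in \<open>simp add: norm_mult\<close>)
      then have "norm (?E ?u - ?E (of_real t * z)) = norm (?J ?u - ?J (of_real t * z))"
        by (simp add: norm_minus_commute)
      moreover have "?J ?u - ?J (of_real t * z) = of_real t ^ m * (?J (z + ?w) - ?J z)"
        unfolding u hpoly_scale by (simp add: right_diff_distrib)
      moreover have "norm (?u - of_real t * z) = t * norm ?w"
        using t unfolding htz by (simp add: norm_mult)
      ultimately have "t ^ m * norm (?J (z + ?w) - ?J z) \<le> t ^ m * (C * ?M ^ m * t * norm ?w)"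
        using t by (simp add: norm_mult norm_power power_mult_distrib mult_ac)
      then have 1: "norm (?J (z + ?w) - ?J z) \<le> C * ?M ^ m * t * norm ?w"
        by (rule mult_left_le_imp_le) (use t in simp)
      have 2: "norm (?J (z + ?w) - ?J z - ?D ?w) \<le> \<epsilon> * norm ?w"
        using \<delta>(2)[of "z + ?w"] elim(1) w by simp
      have "norm (?D ?w) \<le> norm (?J (z + ?w) - ?J z) + norm (?J (z + ?w) - ?J z - ?D ?w)"
        using norm_triangle_ineq4[of "?J (z + ?w) - ?J z" "?J (z + ?w) - ?J z - ?D ?w"] by simp
      also have "\<dots> \<le> (C * ?M ^ m * t + \<epsilon>) * norm ?w" using 1 2 by (simp add: algebra_simps)
      finally have "t ^ (k - 1) * norm (?D (v t)) \<le> t ^ (k - 1) * ((C * ?M ^ m * t + \<epsilon>) * norm (v t))"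
        unfolding w using t by (simp only: dhpoly_scaleR norm_mult norm_of_real) (simp add: mult_ac)
      then have "norm (?D (v t)) \<le> (C * ?M ^ m * t + \<epsilon>) * norm (v t)"
        by (rule mult_left_le_imp_le) (use t in simp)
      then show ?case by (simp add: distrib_right)
    qed
    moreover have "((\<lambda>t. C * ?M ^ m * t * norm (v t) + \<epsilon> * norm (v t)) \<longlongrightarrow> C * ?M ^ m * 0 * norm ?H + \<epsilon> * norm ?H) (at_right 0)"
      by (intro tendsto_intros v_lim)
    moreover have "((\<lambda>t. norm (?D (v t))) \<longlongrightarrow> norm (?D ?H)) (at_right 0)"
      by (intro tendsto_intros D.tendsto v_lim)
    ultimately have "norm (?D ?H) \<le> C * ?M ^ m * 0 * norm ?H + \<epsilon> * norm ?H"
      by (intro tendsto_le[of "at_right 0"]) (auto simp: trivial_limit_at_right_real)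
    then show ?thesis by simp
  qed
  have "((\<lambda>\<epsilon>. \<epsilon> * norm ?H) \<longlongrightarrow> 0 * norm ?H) (at_right 0)" by (intro tendsto_intros)
  moreover have "\<forall>\<^sub>F \<epsilon> in at_right 0. norm (?D ?H) \<le> \<epsilon> * norm ?H"
    using pos by eventually_elim (rule bound)
  ultimately have "norm (?D ?H) \<le> 0 * norm ?H"
    by (rule tendsto_lowerbound) simp
  then show ?thesis by simp
qed

text \<open>The direction \<i> z is tangent to circles, so the form is constant on the unit circle
  and homogeneity does the rest. That circle contains both 1 and -1, which makes a form of odd
  degree vanish.\<close>

lemma hpoly_radial:
  assumes "\<And>z. dhpoly m d z (\<i> * z) = 0"
  shows "hpoly m d z = hpoly m d 1 * of_real (norm z) ^ m" "odd m \<Longrightarrow> hpoly m d 1 = 0"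
proof -
  have der: "((\<lambda>\<theta>. hpoly m d (cis \<theta>)) has_vector_derivative 0) (at \<theta>)" for \<theta>
  proof -
    have "(cis has_derivative (\<lambda>t. t *\<^sub>R (\<i> * cis \<theta>))) (at \<theta>)"
      using has_derivative_cis[OF has_derivative_ident] .
    from has_derivative_compose[OF this hpoly_has_derivative]
    have "((\<lambda>\<theta>. hpoly m d (cis \<theta>)) has_derivative (\<lambda>t. dhpoly m d (cis \<theta>) (t *\<^sub>R (\<i> * cis \<theta>)))) (at \<theta>)" .
    then show ?thesis
      by (simp add: has_vector_derivative_def scaleR_conv_of_real dhpoly_scaleR assms)
  qed
  have const: "hpoly m d (cis \<theta>) = hpoly m d 1" for \<theta>
  proof -
    obtain c where "\<And>x. hpoly m d (cis x) = c"
      using has_vector_derivative_zero_constant[of UNIV "\<lambda>\<theta>. hpoly m d (cis \<theta>)"] der by auto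
    from this[of \<theta>] this[of 0] show ?thesis by simp
  qed
  show "hpoly m d z = hpoly m d 1 * of_real (norm z) ^ m"
  proof (cases "z = 0")
    case False
    then have "z = of_real (norm z) * cis (Arg z)" by (metis rcis_cmod_Arg rcis_def)
    then show ?thesis using hpoly_scale[of m d "norm z" "cis (Arg z)"] const[of "Arg z"] by simp
  next
    case True
    then show ?thesis using hpoly_scale[of m d 0 1] by (simp add: mult.commute)
  qed
  assume "odd m"
  then have "hpoly m d (-1) = - hpoly m d 1" using hpoly_scale[of m d "-1" 1] by simp
  moreover have "hpoly m d (-1) = hpoly m d 1" using const[of pi] by simp
  ultimately show "hpoly m d 1 = 0" by (simp add: equal_neg_zero)
qed

text \<open>Along the line the form H is a polynomial in t whose coefficient of t ^ k is H w. The
  proof reaches that coefficient by homogeneity: s ^ k H (z + w / s) = H (w + s z), with s tending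
  to 0.\<close>

lemma finite_zeros_on_line:
  assumes "hpoly k e w \<noteq> 0"
  shows "finite {t. hpoly k e (z + of_real t * w) = 0}"
proof -
  define p where "p = (\<Sum>i\<le>k. Polynomial.smult (e i) ([:of_real (Re z), of_real (Re w):] ^ i * [:of_real (Im z), of_real (Im w):] ^ (k - i)))"
  have p: "poly p (of_real t) = hpoly k e (z + of_real t * w)" for t
    by (simp add: p_def poly_sum hpoly_def mult.assoc)
  have "p \<noteq> 0"
  proof
    assume "p = 0"
    then have line0: "hpoly k e (z + of_real t * w) = 0" for t using p[of t] by simp
    have "hpoly k e (w + of_real s * z) = 0" if "s \<noteq> 0" for s
      using hpoly_scale[of k e s "z + of_real (1 / s) * w"] line0[of "1 / s"] that by (simp add: algebra_simps)
    then have "\<forall>\<^sub>F s in at 0. hpoly k e (w + of_real s * z) = 0"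
      by (simp add: eventually_at_filter)
    moreover have "((\<lambda>s. hpoly k e (w + of_real s * z)) \<longlongrightarrow> hpoly k e (w + of_real 0 * z)) (at 0)"
      by (intro isCont_tendsto_compose[OF isCont_hpoly] tendsto_intros)
    ultimately have "((\<lambda>s. 0) \<longlongrightarrow> hpoly k e w) (at (0::real))"
      by (subst (asm) tendsto_cong) simp_all
    then have "hpoly k e w = 0" using tendsto_const_iff[of "at (0::real)"] by (metis trivial_limit_at)
    with assms show False by blast
  qed
  then have "finite {x. poly p x = 0}" by (rule poly_roots_finite)
  then have "finite (complex_of_real -` {x. poly p x = 0})"
    by (rule finite_vimageI) (simp add: inj_on_def)
  then show ?thesis by (simp add: vimage_def p)
qed

text \<open>Off the zeros of the form H = \<open>hpoly k e\<close>, tangency to circles makes H z a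
  nonzero real multiple of \<i> z. A zero of H is a limit, along a line, of points where H does not
  vanish, and continuity covers it.\<close>

lemma dhpoly_rotational_eq_0:
  assumes H: "hpoly k e w \<noteq> 0" and perp: "\<And>z. Re (cnj z * hpoly k e z) = 0"
    and d: "\<And>z. dhpoly m d z (hpoly k e z) = 0"
  shows "dhpoly m d z (\<i> * z) = 0"
proof -
  have nz: "dhpoly m d z (\<i> * z) = 0" if "hpoly k e z \<noteq> 0" for z
  proof (cases "z = 0")
    case True then show ?thesis using dhpoly_scaleR[of m d z 0 0] by simp
  next
    case False
    define s where "s = Im (cnj z * hpoly k e z) / (norm z)\<^sup>2"
    have "cnj z * hpoly k e z = \<i> * of_real (Im (cnj z * hpoly k e z))"
      using perp[of z] by (simp add: complex_eq_iff)
    then have "z * (cnj z * hpoly k e z) = z * (\<i> * of_real (Im (cnj z * hpoly k e z)))" by simp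
    then have "of_real ((norm z)\<^sup>2) * hpoly k e z = z * (\<i> * of_real (Im (cnj z * hpoly k e z)))"
      by (simp only: mult.assoc[symmetric] complex_norm_square)
    then have H_eq: "hpoly k e z = of_real s * (\<i> * z)"
      using False by (simp add: s_def field_simps)
    then have "s \<noteq> 0" using that by auto
    with d[of z] show ?thesis unfolding H_eq dhpoly_scaleR by simp
  qed
  let ?R = "\<lambda>t. dhpoly m d (z + of_real t * w) (\<i> * (z + of_real t * w))"
  let ?F = "{t. hpoly k e (z + of_real t * w) = 0}"
  have "\<forall>\<^sub>F t in at 0. t \<notin> ?F"
    using islimpt_finite[OF finite_zeros_on_line[OF H, of z], of 0] unfolding islimpt_iff_eventually by blast
  then have "\<forall>\<^sub>F t in at 0. ?R t = 0" by eventually_elim (use nz in auto)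
  moreover have "(?R \<longlongrightarrow> dhpoly m d (z + of_real 0 * w) (\<i> * (z + of_real 0 * w))) (at 0)"
    unfolding dhpoly_def by (intro tendsto_intros)
  ultimately have "((\<lambda>t. 0) \<longlongrightarrow> dhpoly m d z (\<i> * z)) (at (0::real))"
    by (subst (asm) tendsto_cong) simp_all
  then show ?thesis using tendsto_const_iff[of "at (0::real)"] by (metis trivial_limit_at)
qed

section \<open>Order estimates for composed germs and the invariant quadratic part\<close>

lemma order_ge_compose:
  assumes "order_ge N f" "order_ge 1 u"
  shows "order_ge N (\<lambda>z. f (u z))"
proof -
  obtain C r where C: "0 < C" "0 < r" "\<And>z. norm z < r \<Longrightarrow> norm (f z) \<le> C * norm z ^ N"
    by (rule order_geE[OF assms(1)]) (rule that)
  obtain B s where B: "0 < B" "0 < s" "\<And>z. norm z < s \<Longrightarrow> norm (u z) \<le> B * norm z ^ 1"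
    by (rule order_geE[OF assms(2)]) (rule that)
  show ?thesis
  proof (rule order_geI[of "min s (r / B)"])
    fix z :: complex assume z: "norm z < min s (r / B)"
    have u: "norm (u z) \<le> B * norm z" using B(3)[of z] z by simp
    also have "\<dots> < r" using z B(1) by (simp add: field_simps)
    finally have "norm (f (u z)) \<le> C * norm (u z) ^ N" by (rule C(3))
    also have "\<dots> \<le> C * (B * norm z) ^ N"
      using u C(1) by (intro mult_left_mono power_mono) auto
    finally show "norm (f (u z)) \<le> (C * B ^ N) * norm z ^ N" by (simp add: power_mult_distrib mult_ac)
  qed (use B C in simp)
qed

text \<open>For a quadratic form J this compares J (f z) with J (\<mu> z): N = 1 and M = 2 give
  order 3, so replacing f by its linear part leaves the quadratic terms alone.\<close>

lemma order_ge_lipschitz: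
  assumes "real_analytic_at J 0" "order_ge (Suc N) J" "order_ge 1 u" "order_ge 1 v"
    and uv: "order_ge M (\<lambda>z. u z - v z)"
  shows "order_ge (N + M) (\<lambda>z. J (u z) - J (v z))"
proof -
  obtain C r where C: "0 < C" "0 < r"
    "\<And>\<rho> u v. \<rho> < r \<Longrightarrow> norm u \<le> \<rho> \<Longrightarrow> norm v \<le> \<rho> \<Longrightarrow> norm (J u - J v) \<le> C * \<rho> ^ N * norm (u - v)"
    by (rule real_analytic_lipschitz[OF assms(1,2)]) (rule that)
  obtain B1 s1 where B1: "0 < B1" "0 < s1" "\<And>z. norm z < s1 \<Longrightarrow> norm (u z) \<le> B1 * norm z ^ 1"
    by (rule order_geE[OF assms(3)]) (rule that)
  obtain B2 s2 where B2: "0 < B2" "0 < s2" "\<And>z. norm z < s2 \<Longrightarrow> norm (v z) \<le> B2 * norm z ^ 1"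
    by (rule order_geE[OF assms(4)]) (rule that)
  obtain D s where D: "0 < D" "0 < s" "\<And>z. norm z < s \<Longrightarrow> norm (u z - v z) \<le> D * norm z ^ M"
    by (rule order_geE[OF uv]) (rule that)
  define B where "B = B1 + B2"
  have B: "0 < B" "B1 \<le> B" "B2 \<le> B" using B1 B2 by (auto simp: B_def)
  show ?thesis
  proof (rule order_geI[of "min (min s1 s2) (min s (r / B))"])
    fix z :: complex assume z: "norm z < min (min s1 s2) (min s (r / B))"
    have "norm (u z) \<le> B1 * norm z" using B1(3)[of z] z by simp
    also have "\<dots> \<le> B * norm z" using B by (intro mult_right_mono) auto
    finally have u: "norm (u z) \<le> B * norm z" .
    have "norm (v z) \<le> B2 * norm z" using B2(3)[of z] z by simp
    also have "\<dots> \<le> B * norm z" using B by (intro mult_right_mono) auto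
    finally have v: "norm (v z) \<le> B * norm z" .
    have "norm (J (u z) - J (v z)) \<le> C * (B * norm z) ^ N * norm (u z - v z)"
      by (rule C(3)) (use z B u v in \<open>auto simp: field_simps\<close>)
    also have "\<dots> \<le> C * (B * norm z) ^ N * (D * norm z ^ M)"
      using D(3)[of z] z C B by (intro mult_left_mono) auto
    finally show "norm (J (u z) - J (v z)) \<le> (C * B ^ N * D) * norm z ^ (N + M)"
      by (simp add: power_mult_distrib power_add mult_ac)
  qed (use B B1 B2 C D in simp)
qed

lemma order_ge_2_imp_has_derivative_0:
  assumes "order_ge 2 g"
  shows "(g has_derivative (\<lambda>_. 0)) (at 0)"
proof -
  obtain C r where C: "0 < C" "0 < r" "\<And>z. norm z < r \<Longrightarrow> norm (g z) \<le> C * norm z ^ 2"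
    by (rule order_geE[OF assms]) (rule that)
  have "g 0 = 0" using C(3)[of 0] C(2) by simp
  have gt: "order_gt 1 g" by (rule order_ge_imp_gt) (use assms in \<open>simp add: numeral_2_eq_2\<close>)
  show ?thesis unfolding has_derivative_at_alt
  proof (intro conjI allI impI bounded_linear_zero)
    fix e :: real assume "0 < e"
    then have "\<forall>\<^sub>F z in nhds 0. norm (g z) \<le> e * norm z ^ 1" using gt unfolding order_gt_def by blast
    then show "\<exists>d>0. \<forall>y. norm (y - 0) < d \<longrightarrow> norm (g y - g 0 - 0) \<le> e * norm (y - 0)"
      unfolding eventually_nhds_metric by (simp add: \<open>g 0 = 0\<close>)
  qed
qed

text \<open>Differentiability gives o(|z|); analyticity raises it to O(|z|^2).\<close>

lemma has_derivative_0_imp_order_ge_2: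
  assumes "real_analytic_at g 0" "g 0 = 0" "(g has_derivative (\<lambda>_. 0)) (at 0)"
  shows "order_ge 2 g"
proof -
  have gt: "order_gt 1 g" unfolding order_gt_def
  proof (intro allI impI)
    fix e :: real assume "0 < e"
    then obtain d where "d > 0" "\<And>y. norm (y - 0) < d \<Longrightarrow> norm (g y - g 0 - 0) \<le> e * norm (y - 0)"
      using assms(3) unfolding has_derivative_at_alt by meson
    then show "\<forall>\<^sub>F z in nhds 0. norm (g z) \<le> e * norm z ^ 1"
      unfolding eventually_nhds_metric using assms(2) by auto
  qed
  then have "\<forall>\<^sub>F z in nhds 0. norm (g z) \<le> 1 * norm z ^ 1" unfolding order_gt_def using zero_less_one by blast
  then have "order_ge 1 g" unfolding order_ge_def by (rule exI)
  from real_analytic_order_Suc[OF assms(1) this gt] show ?thesis by (simp add: numeral_2_eq_2)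
qed

lemma order_ge_1_linear: "order_ge 1 (\<lambda>z. a * z)"
  unfolding order_ge_def by (rule exI[of _ "norm a"]) (simp add: norm_mult)

text \<open>Evaluating at (1, 0), (0, 1), (1, 1) and cancelling b leaves a linear system for d0 - d2
  and d1 with determinant -(a^2 + b^2) = -1. Cancelling b rules out the identity and the half turn,
  under which each quadratic form is invariant.\<close>

lemma rotation_invariant_quadratic:
  fixes d0 d1 d2 :: complex and a b :: real
  assumes "a\<^sup>2 + b\<^sup>2 = 1" "b \<noteq> 0"
    and inv: "\<And>x y. d0 * of_real ((b * x + a * y)\<^sup>2) + d1 * of_real ((a * x - b * y) * (b * x + a * y))
        + d2 * of_real ((a * x - b * y)\<^sup>2)
      = d0 * of_real (y\<^sup>2) + d1 * of_real (x * y) + d2 * of_real (x\<^sup>2)"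
  shows "d1 = 0 \<and> d0 = d2"
proof -
  define A where "A = complex_of_real a"
  define B where "B = complex_of_real b"
  have AB: "A\<^sup>2 + B\<^sup>2 = 1" "B \<noteq> 0"
    using assms(1,2) unfolding A_def B_def by (simp_all flip: of_real_power of_real_add)
  have e1: "d0 * B\<^sup>2 + d1 * (A * B) + d2 * A\<^sup>2 = d2"
    using inv[of 1 0] by (simp add: A_def B_def)
  have e2: "d0 * A\<^sup>2 - d1 * (A * B) + d2 * B\<^sup>2 = d0"
    using inv[of 0 1] by (simp add: A_def B_def algebra_simps)
  have e3: "d0 * (B + A)\<^sup>2 + d1 * ((A - B) * (B + A)) + d2 * (A - B)\<^sup>2 = d0 + d1 + d2"
    using inv[of 1 1] by (simp add: A_def B_def)
  have "B * (B * (d0 - d2) + A * d1) = (d0 * B\<^sup>2 + d1 * (A * B) + d2 * A\<^sup>2) - d2 * (A\<^sup>2 + B\<^sup>2)"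
    by (simp add: algebra_simps power2_eq_square)
  also have "\<dots> = 0" unfolding e1 AB(1) by simp
  finally have "B * (B * (d0 - d2) + A * d1) = 0" .
  then have f1: "B * (d0 - d2) + A * d1 = 0" using AB(2) by simp
  have "2 * B * (A * (d0 - d2) - B * d1) = (d0 * (B + A)\<^sup>2 + d1 * ((A - B) * (B + A)) + d2 * (A - B)\<^sup>2)
      - (d0 * B\<^sup>2 + d1 * (A * B) + d2 * A\<^sup>2) - (d0 * A\<^sup>2 - d1 * (A * B) + d2 * B\<^sup>2) - d1 * (A\<^sup>2 + B\<^sup>2)"
    by (simp add: algebra_simps power2_eq_square)
  also have "\<dots> = 0" unfolding e1 e2 e3 AB(1) by simp
  finally have "2 * B * (A * (d0 - d2) - B * d1) = 0" .
  then have f2: "A * (d0 - d2) - B * d1 = 0" using AB(2) by simp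
  have "d1 * (A\<^sup>2 + B\<^sup>2) = A * (B * (d0 - d2) + A * d1) - B * (A * (d0 - d2) - B * d1)"
    by (simp add: algebra_simps power2_eq_square)
  then have "d1 = 0" unfolding f1 f2 AB(1) by simp
  moreover from this f1 AB(2) have "d0 = d2" by simp
  ultimately show ?thesis by simp
qed

lemma hpoly_2: "hpoly 2 d z = d 0 * of_real ((Im z)\<^sup>2) + d 1 * of_real (Re z * Im z) + d 2 * of_real ((Re z)\<^sup>2)"
proof -
  have "{..2::nat} = {0, 1, 2}" by auto
  then show ?thesis by (simp add: hpoly_def)
qed

text \<open>Modulo order 3, K (f z) = K z says that the quadratic form of K is invariant under
  multiplication by \<mu>. The approximation is stated twice: through |z|^2 for matching powers,
  through \<open>hpoly\<close> for use as a leading form.\<close>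

lemma invariant_quadratic_part:
  assumes K: "real_analytic_at K 0" "order_ge 2 K" and f: "order_ge 2 (\<lambda>z. f z - \<mu> * z)"
    and inv: "\<forall>\<^sub>F z in nhds 0. K (f z) = K z" and \<mu>: "norm \<mu> = 1" "Im \<mu> \<noteq> 0"
  obtains c where "order_ge 3 (\<lambda>z. K z - c * of_real ((norm z)\<^sup>2))"
    "order_ge 3 (\<lambda>z. K z - hpoly 2 (\<lambda>i. if i = 1 then 0 else c) z)"
proof -
  obtain d where d: "order_ge (Suc 2) (\<lambda>z. K z - hpoly 2 d z)"
    by (rule real_analytic_leading[OF K]) (rule that)
  let ?J = "hpoly 2 d"
  have "order_ge 2 (\<lambda>z. K z - (K z - ?J z))" by (intro order_ge_diff K order_ge_mono[OF d]) simp
  then have J: "order_ge (Suc 1) ?J" by (simp add: numeral_2_eq_2)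
  have f1: "order_ge 1 f"
    using order_ge_add[OF order_ge_mono[OF f, of 1] order_ge_1_linear[of \<mu>]] by simp
  have A: "order_ge (1 + 2) (\<lambda>z. ?J (f z) - ?J (\<mu> * z))"
    by (rule order_ge_lipschitz[OF real_analytic_hpoly J f1 order_ge_1_linear f])
  have B: "order_ge (Suc 2) (\<lambda>z. K (f z) - ?J (f z))" by (rule order_ge_compose[OF d f1])
  have d3: "order_ge 3 (\<lambda>z. K z - ?J z)" using d by simp
  have B3: "order_ge 3 (\<lambda>z. K (f z) - ?J (f z))" using B by simp
  have A3: "order_ge 3 (\<lambda>z. ?J (f z) - ?J (\<mu> * z))" using A by (simp add: numeral_3_eq_3)
  have "order_ge 3 (\<lambda>z. (K z - ?J z) - (K (f z) - ?J (f z)) - (?J (f z) - ?J (\<mu> * z)))"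
    by (rule order_ge_diff[OF order_ge_diff[OF d3 B3] A3])
  then have "order_ge 3 (\<lambda>z. ?J (\<mu> * z) - ?J z)"
    by (rule order_ge_cong) (use inv in eventually_elim, simp)
  then have "order_gt 2 (\<lambda>z. ?J (\<mu> * z) - ?J z)" by (intro order_ge_imp_gt) simp
  moreover have "?J (\<mu> * (of_real t * z)) - ?J (of_real t * z) = of_real t ^ 2 * (?J (\<mu> * z) - ?J z)" for t z
    using hpoly_scale[of 2 d t "\<mu> * z"] hpoly_scale[of 2 d t z] by (simp add: mult_ac right_diff_distrib)
  ultimately have "?J (\<mu> * z) - ?J z = 0" for z
    by (intro homogeneous_eq_0_if_order_gt[of "\<lambda>z. ?J (\<mu> * z) - ?J z" 2])
  then have Jinv: "?J (\<mu> * Complex x y) = ?J (Complex x y)" for x y by simp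
  have "d 1 = 0 \<and> d 0 = d 2"
  proof (rule rotation_invariant_quadratic)
    show "(Re \<mu>)\<^sup>2 + (Im \<mu>)\<^sup>2 = 1" using \<mu>(1) cmod_power2[of \<mu>] by simp
    show "d 0 * of_real ((Im \<mu> * x + Re \<mu> * y)\<^sup>2) + d 1 * of_real ((Re \<mu> * x - Im \<mu> * y) * (Im \<mu> * x + Re \<mu> * y))
        + d 2 * of_real ((Re \<mu> * x - Im \<mu> * y)\<^sup>2)
      = d 0 * of_real (y\<^sup>2) + d 1 * of_real (x * y) + d 2 * of_real (x\<^sup>2)" for x y
      using Jinv[of x y] unfolding hpoly_2 by (simp add: add.commute)
  qed (rule \<mu>(2))
  then have d1: "d 1 = 0" and d0: "d 0 = d 2" by auto
  have "?J z = d 2 * of_real ((norm z)\<^sup>2)" "?J z = hpoly 2 (\<lambda>i. if i = 1 then 0 else d 2) z" for z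
    unfolding hpoly_2 cmod_power2 using d1 d0 by (simp_all add: algebra_simps)
  with d3 show ?thesis by (intro that[of "d 2"]) simp_all
qed

text \<open>For nonzero c and z the kernel in h is the tangent line of the circle through z.\<close>

lemma dhpoly_2_radial: "dhpoly 2 (\<lambda>i. if i = 1 then 0 else c) z h = 2 * c * of_real (Re (cnj z * h))"
proof -
  have "{..2::nat} = {0, 1, 2}" by auto
  then show ?thesis by (simp add: dhpoly_def algebra_simps)
qed

text \<open>Telescoping: K ^ (l + 1) - Q ^ (l + 1) = K (K ^ l - Q ^ l) + (K - Q) Q ^ l. For Q = c
  |z|^2 the order is one above the degree of Q ^ l, which is therefore the leading form of K ^
  l.\<close>

lemma order_ge_power_diff:
  assumes "order_ge 2 K" "order_ge 2 Q" "order_ge 3 (\<lambda>z. K z - Q z)"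
  shows "order_ge (2 * l + 1) (\<lambda>z. K z ^ l - Q z ^ l)"
proof (induction l)
  case 0
  show ?case by (rule order_geI[of 1 _ 0]) auto
next
  case (Suc l)
  have Ql: "order_ge (2 * l) (\<lambda>z. Q z ^ l)"
  proof (induction l)
    case 0 show ?case using order_ge_const[of 1] by simp
  next
    case (Suc l) show ?case using order_ge_mult[OF assms(2) Suc] by simp
  qed
  have "order_ge (2 * l + 3) (\<lambda>z. K z * (K z ^ l - Q z ^ l) + (K z - Q z) * Q z ^ l)"
    using order_ge_mult[OF assms(1) Suc] order_ge_mult[OF assms(3) Ql]
    by (intro order_ge_add) (simp_all add: numeral_3_eq_3 add.commute)
  then show ?case by (simp add: algebra_simps numeral_3_eq_3)
qed

section \<open>Formal dependence of first integrals\<close>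

lemma real_analytic_poly:
  assumes "real_analytic_at K 0"
  shows "real_analytic_at (\<lambda>z. poly p (K z) :: complex) 0"
  unfolding poly_altdef
  by (intro real_analytic_sum real_analytic_mult real_analytic_const real_analytic_power assms)

text \<open>If \<open>g\<close> is not the identity, every first integral of \<open>g\<close> has a leading form that is constant
  on circles, so it can be matched by a multiple of a power of \<open>K\<close> and removed.\<close>

lemma first_integral_formal_function:
  assumes h: "real_analytic_at h 0" "order_ge 2 h" "\<not> (\<forall>\<^sub>F z in nhds 0. h z = 0)"
    and K: "real_analytic_at K 0" "order_ge 2 K" "\<forall>\<^sub>F z in nhds 0. K (z + h z) = K z" "c \<noteq> 0"
      "order_ge 3 (\<lambda>z. K z - c * of_real ((norm z)\<^sup>2))"
      "order_ge 3 (\<lambda>z. K z - hpoly 2 (\<lambda>i. if i = 1 then 0 else c) z)"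
    and L: "real_analytic_at L 0" "\<forall>\<^sub>F z in nhds 0. L (z + h z) = L z"
  shows "\<exists>p. order_ge N (\<lambda>z. L z - poly p (K z))"
proof -
  have "\<exists>N. \<not> order_ge N h" using real_analytic_flat_eq_0[OF h(1)] h(3) by blast
  then obtain N0 where N0: "\<not> order_ge N0 h" "\<And>M. M < N0 \<Longrightarrow> order_ge M h"
    using exists_least_iff[of "\<lambda>N. \<not> order_ge N h"] by blast
  have "2 < N0" using order_ge_mono[OF h(2), of N0] N0(1) by (meson not_le)
  \<comment> \<open>\<open>N0\<close> is the first order that fails, so k is the exact order of h;
    it exists because h is not flat.\<close>
  define k where "k = N0 - 1"
  have k: "2 \<le> k" "order_ge k h" "\<not> order_ge (Suc k) h"
    using \<open>2 < N0\<close> N0 by (auto simp: k_def)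
  obtain e where e: "order_ge (Suc k) (\<lambda>z. h z - hpoly k e z)"
    by (rule real_analytic_leading[OF h(1) k(2)]) (rule that)
  have "\<exists>w. hpoly k e w \<noteq> 0"
  proof (rule ccontr)
    assume "\<not> (\<exists>w. hpoly k e w \<noteq> 0)"
    with e have "order_ge (Suc k) h" by simp
    with k(3) show False by blast
  qed
  then obtain w where w: "hpoly k e w \<noteq> 0" by blast
  have K3: "order_ge (Suc 2) (\<lambda>z. K z - hpoly 2 (\<lambda>i. if i = 1 then 0 else c) z)" using K(6) by simp
  \<comment> \<open>K is itself a first integral: its leading form c |z|^2 forces the leading form
    of h to be orthogonal to z.\<close>
  have perp: "Re (cnj z * hpoly k e z) = 0" for z
  proof -
    have "2 * c * complex_of_real (Re (cnj z * hpoly k e z)) = 0"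
      using leading_term_orthogonal[OF K(1,3) K3 e k(1), of z] unfolding dhpoly_2_radial .
    with K(4) show ?thesis by (simp only: mult_eq_0_iff of_real_eq_0_iff) simp
  qed
  have ord_norm2: "order_ge 2 (\<lambda>z. c * of_real ((norm z)\<^sup>2))"
    by (rule order_geI[of 1 _ "norm c"]) (auto simp: norm_mult norm_power)
  show ?thesis
  proof (induction N)
    case 0
    show ?case by (rule exI[of _ 0]) (use real_analytic_order_ge_0[OF L(1)] in simp)
  next
    case (Suc N)
    then obtain p where p: "order_ge N (\<lambda>z. L z - poly p (K z))" by blast
    let ?E = "\<lambda>z. L z - poly p (K z)"
    have E: "real_analytic_at ?E 0" by (intro real_analytic_diff real_analytic_poly L K)
    obtain d where d: "order_ge (Suc N) (\<lambda>z. ?E z - hpoly N d z)"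
      by (rule real_analytic_leading[OF E p]) (rule that)
    \<comment> \<open>The remainder is again a first integral, so its leading form is constrained in
      the same way.\<close>
    have "\<forall>\<^sub>F z in nhds 0. ?E (z + h z) = ?E z"
      using K(3) L(2) by eventually_elim simp
    note orth = leading_term_orthogonal[OF E this d e k(1)]
    have rot: "dhpoly N d z (\<i> * z) = 0" for z
      by (rule dhpoly_rotational_eq_0[OF w perp orth])
    let ?A = "hpoly N d 1"
    have J: "hpoly N d z = ?A * of_real (norm z) ^ N" for z by (rule hpoly_radial(1)[OF rot])
    show ?case
    proof (cases "even N")
      case False
      then have "?A = 0" by (rule hpoly_radial(2)[OF rot])
      then have "hpoly N d z = 0" for z by (subst J) simp
      with d have "order_ge (Suc N) ?E" by simp
      then show ?thesis by blast
    next
      case True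
      then obtain l where l: "N = 2 * l" by blast
      \<comment> \<open>K ^ l has leading form c ^ l |z| ^ (2 l), whence the division by c ^
        l.\<close>
      let ?p = "p + Polynomial.monom (?A / c ^ l) l"
      have "order_ge (Suc N) (\<lambda>z. K z ^ l - (c * of_real ((norm z)\<^sup>2)) ^ l)"
        using order_ge_power_diff[OF K(2) ord_norm2 K(5), of l] by (simp add: l)
      from order_ge_diff[OF d order_ge_cmult[OF this, of "?A / c ^ l"]]
      have "order_ge (Suc N) (\<lambda>z. (?E z - hpoly N d z) - ?A / c ^ l * (K z ^ l - (c * of_real ((norm z)\<^sup>2)) ^ l))" .
      moreover have "(?E z - hpoly N d z) - ?A / c ^ l * (K z ^ l - (c * of_real ((norm z)\<^sup>2)) ^ l) = L z - poly ?p (K z)" for z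
      proof -
        have "hpoly N d z = ?A * (of_real ((norm z)\<^sup>2)) ^ l" unfolding J[of z] by (simp add: l power_mult)
        then show ?thesis using K(4) by (simp add: poly_monom power_mult_distrib field_simps)
      qed
      ultimately have "order_ge (Suc N) (\<lambda>z. L z - poly ?p (K z))"
        by (rule order_ge_cong[OF _ always_eventually[OF allI]])
      then show ?thesis by blast
    qed
  qed
qed

text \<open>For E = L - P(K) one has dK wedge dL = dK wedge dE. The right side inherits the order of
  dE while the left side does not depend on P, so the Jacobian is flat.\<close>

lemma jacobian_eq_0_of_formal_function:
  assumes K: "real_analytic_at K 0" and L: "real_analytic_at L 0"
    and ex: "\<And>N. \<exists>p. order_ge N (\<lambda>z. L z - poly p (K z))"
  obtains kx ky lx ly where
    "\<forall>\<^sub>F z in nhds 0. (K has_derivative (\<lambda>h. kx z * of_real (Re h) + ky z * of_real (Im h))) (at z)"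
    "\<forall>\<^sub>F z in nhds 0. (L has_derivative (\<lambda>h. lx z * of_real (Re h) + ly z * of_real (Im h))) (at z)"
    "\<forall>\<^sub>F z in nhds 0. kx z * ly z - ky z * lx z = 0"
proof -
  obtain kx ky where k: "real_analytic_at kx 0" "real_analytic_at ky 0"
    "\<forall>\<^sub>F z in nhds 0. (K has_derivative (\<lambda>h. kx z * of_real (Re h) + ky z * of_real (Im h))) (at z)"
    by (rule real_analytic_has_derivative[OF K]) (rule that)
  obtain lx ly where l: "real_analytic_at lx 0" "real_analytic_at ly 0"
    "\<forall>\<^sub>F z in nhds 0. (L has_derivative (\<lambda>h. lx z * of_real (Re h) + ly z * of_real (Im h))) (at z)"
    by (rule real_analytic_has_derivative[OF L]) (rule that)
  let ?D = "\<lambda>z. kx z * ly z - ky z * lx z"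
  have "order_ge N ?D" for N
  proof -
    \<comment> \<open>One order above the target, to be lost in differentiating
      \<open>?E\<close>.\<close>
    obtain p where p: "order_ge (Suc N) (\<lambda>z. L z - poly p (K z))" using ex by blast
    let ?E = "\<lambda>z. L z - poly p (K z)"
    have "real_analytic_at ?E 0" by (intro real_analytic_diff real_analytic_poly L K)
    then obtain ex ey where e: 
      "\<forall>\<^sub>F z in nhds 0. (?E has_derivative (\<lambda>h. ex z * of_real (Re h) + ey z * of_real (Im h))) (at z)"
      "\<And>N. order_ge (Suc N) ?E \<Longrightarrow> order_ge N ex \<and> order_ge N ey"
      by (rule real_analytic_has_derivative) (rule that)
    have ord: "order_ge N ex" "order_ge N ey" using e(2)[OF p] by auto
    have "order_ge (0 + N) (\<lambda>z. kx z * ey z - ky z * ex z)"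
      by (intro order_ge_diff order_ge_mult real_analytic_order_ge_0 k ord)
    moreover have "\<forall>\<^sub>F z in nhds 0. kx z * ey z - ky z * ex z = ?D z"
      using k(3) l(3) e(1)
    proof eventually_elim
      case (elim z)
      let ?q = "poly (pderiv p) (K z)"
      have "(poly p has_derivative (\<lambda>h. ?q * h)) (at (K z))"
        using poly_DERIV[of p "K z"] by (simp add: has_field_derivative_def)
      from has_derivative_compose[OF elim(1) this]
      have "((\<lambda>z. poly p (K z)) has_derivative (\<lambda>h. ?q * (kx z * of_real (Re h) + ky z * of_real (Im h)))) (at z)" .
      from has_derivative_unique[OF elim(3) has_derivative_diff[OF elim(2) this]]
      have *: "(\<lambda>h. ex z * of_real (Re h) + ey z * of_real (Im h)) =
        (\<lambda>h. lx z * of_real (Re h) + ly z * of_real (Im h) - ?q * (kx z * of_real (Re h) + ky z * of_real (Im h)))" .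
      have exy: "ex z = lx z - ?q * kx z" "ey z = ly z - ?q * ky z"
        using fun_cong[OF *, of 1] fun_cong[OF *, of \<i>] by simp_all
      show ?case unfolding exy by (simp add: algebra_simps)
    qed
    ultimately show ?thesis using order_ge_cong by simp
  qed
  then have "\<forall>\<^sub>F z in nhds 0. ?D z = 0"
    by (rule real_analytic_flat_eq_0[rotated]) (intro real_analytic_diff real_analytic_mult k l)
  with k l show ?thesis by (intro that)
qed

subsection \<open>Linearisation\<close>

lemma real_analytic_funpow:
  assumes "real_analytic_at (f :: complex \<Rightarrow> complex) 0" "f 0 = 0"
  shows "real_analytic_at (f ^^ j) 0" "(f ^^ j) 0 = 0"
proof (induction j)
  case 0
  { case 1 show ?case using real_analytic_ident by (simp add: id_def) }
  { case 2 show ?case by simp }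
next
  case (Suc j)
  { case 1 show ?case using real_analytic_compose[OF assms(1) Suc.IH] by (simp add: o_def) }
  { case 2 show ?case using Suc.IH assms by simp }
qed

lemma funpow_has_derivative:
  assumes "(f has_derivative (\<lambda>h. \<mu> * h)) (at (0::complex))" "f 0 = 0"
  shows "(f ^^ j has_derivative (\<lambda>h. \<mu> ^ j * h)) (at 0) \<and> (f ^^ j) 0 = 0"
proof (induction j)
  case 0
  show ?case by (simp add: id_def)
next
  case (Suc j)
  have "(f has_derivative (\<lambda>h. \<mu> * h)) (at ((f ^^ j) 0))" using Suc assms by simp
  from has_derivative_compose[OF conjunct1[OF Suc] this] show ?case
    using Suc assms(2) by (simp add: o_def mult.assoc)
qed

lemma funpow_first_integral:
  assumes "real_analytic_at (f :: complex \<Rightarrow> complex) 0" "f 0 = 0" "\<forall>\<^sub>F z in nhds 0. K (f z) = K z"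
  shows "\<forall>\<^sub>F z in nhds 0. K ((f ^^ j) z) = K z"
proof (induction j)
  case (Suc j)
  from real_analytic_eventually_compose[OF real_analytic_funpow[OF assms(1,2)] assms(3), of j] Suc
  show ?case by eventually_elim simp
qed simp

lemma of_real_has_derivativeD:
  assumes "((\<lambda>z. complex_of_real (u z)) has_derivative (\<lambda>h. a * of_real (Re h) + b * of_real (Im h))) (at z)"
  shows "(u has_derivative (\<lambda>h. Re a * Re h + Re b * Im h)) (at z)"
    and "a = of_real (Re a)" "b = of_real (Re b)"
proof -
  from bounded_linear.has_derivative[OF bounded_linear_Re assms]
  show u: "(u has_derivative (\<lambda>h. Re a * Re h + Re b * Im h)) (at z)" by simp
  from has_derivative_unique[OF bounded_linear.has_derivative[OF bounded_linear_of_real u] assms]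
  have *: "(\<lambda>h. complex_of_real (Re a * Re h + Re b * Im h)) = (\<lambda>h. a * of_real (Re h) + b * of_real (Im h))" .
  from fun_cong[OF *, of 1] fun_cong[OF *, of \<i>] show "a = of_real (Re a)" "b = of_real (Re b)"
    by simp_all
qed

text \<open>Used contrapositively: a positive Hessian forces a nonzero quadratic part. Order 3 gives
  the first partial derivative order 2, so its differential vanishes at 0.\<close>

lemma hessian_eq_0_of_order_ge_3:
  fixes I :: "complex \<Rightarrow> real"
  assumes "real_analytic_at (\<lambda>z. complex_of_real (I z - I 0)) 0" "order_ge 3 (\<lambda>z. complex_of_real (I z - I 0))"
  shows "hessian I 0 1 1 = 0"
proof -
  obtain fx fy where der: "\<forall>\<^sub>F z in nhds 0. ((\<lambda>z. complex_of_real (I z - I 0)) has_derivative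
      (\<lambda>h. fx z * of_real (Re h) + fy z * of_real (Im h))) (at z)"
    and ord: "\<And>N. order_ge (Suc N) (\<lambda>z. complex_of_real (I z - I 0)) \<Longrightarrow> order_ge N fx \<and> order_ge N fy"
    by (rule real_analytic_has_derivative[OF assms(1)]) (rule that)
  have "order_ge 2 fx" using ord[of 2] assms(2) by simp
  from bounded_linear.has_derivative[OF bounded_linear_Re order_ge_2_imp_has_derivative_0[OF this]]
  have "((\<lambda>w. Re (fx w)) has_derivative (\<lambda>_. 0)) (at 0)" by simp
  moreover from der have ev: "\<forall>\<^sub>F w in nhds 0. Re (fx w) = frechet_derivative I (at w) 1"
  proof eventually_elim
    case (elim z)
    from has_derivative_add_const[OF of_real_has_derivativeD(1)[OF elim], of "I 0"]
    have "(I has_derivative (\<lambda>h. Re (fx z) * Re h + Re (fy z) * Im h)) (at z)" by simp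
    from frechet_derivative_at[OF this] show ?case by (metis (no_types, lifting) add.right_neutral mult.right_neutral mult_zero_right one_complex.simps)
  qed
  ultimately have "((\<lambda>w. frechet_derivative I (at w) 1) has_derivative (\<lambda>_. 0)) (at 0)"
    using eventually_nhds_x_imp_x[OF ev] has_derivative_transform_eventually[of "\<lambda>w. Re (fx w)" "\<lambda>_. 0" 0 UNIV]
      eventually_nhds_conv_at by blast
  from frechet_derivative_at[OF this] show ?thesis unfolding hessian_def by metis
qed

lemma functionally_dependent_at:
  fixes I J :: "complex \<Rightarrow> real"
  assumes I: "((\<lambda>z. complex_of_real (I z - a)) has_derivative (\<lambda>h. kx * of_real (Re h) + ky * of_real (Im h))) (at z)"
    and J: "((\<lambda>z. complex_of_real (J z)) has_derivative (\<lambda>h. lx * of_real (Re h) + ly * of_real (Im h))) (at z)"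
    and det: "kx * ly - ky * lx = 0"
    and indep: "functionally_independent_on I J V" and z: "z \<in> V"
  shows False
proof -
  have r: "kx = of_real (Re kx)" "ky = of_real (Re ky)" "lx = of_real (Re lx)" "ly = of_real (Re ly)"
    by (rule of_real_has_derivativeD(2,3)[OF I] of_real_has_derivativeD(2,3)[OF J])+
  have "complex_of_real (Re kx * Re ly - Re ky * Re lx) = 0"
    using det by (subst (asm) r(1), subst (asm) r(2), subst (asm) r(3), subst (asm) r(4)) simp
  then have det': "Re kx * Re ly = Re ky * Re lx" by (simp only: of_real_eq_0_iff)
  have "(I has_derivative (\<lambda>h. Re kx * Re h + Re ky * Im h)) (at z)"
    using has_derivative_add_const[OF of_real_has_derivativeD(1)[OF I], of a] by simp
  note dI = frechet_derivative_at[OF this, symmetric]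
  note dJ = frechet_derivative_at[OF of_real_has_derivativeD(1)[OF J], symmetric]
  have ind: "\<alpha> = 0 \<and> \<beta> = 0"
    if "\<And>v. \<alpha> * (Re kx * Re v + Re ky * Im v) + \<beta> * (Re lx * Re v + Re ly * Im v) = 0" for \<alpha> \<beta>
    using indep z that unfolding functionally_independent_on_def dI dJ by (metis (no_types, lifting) dI dJ)
  \<comment> \<open>Since the determinant is 0, (lx, -kx) and (ly, -ky) are relations between the
    differentials. Independence then makes all four partial derivatives zero, so (1, 0) is a
    relation too, a contradiction.\<close>
  have "Re lx = 0 \<and> - Re kx = 0"
    by (rule ind) (use det' in \<open>simp add: algebra_simps\<close>)
  moreover have "Re ly = 0 \<and> - Re ky = 0"
    by (rule ind) (use det' in \<open>simp add: algebra_simps\<close>)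
  ultimately have "(1::real) = 0 \<and> (0::real) = 0" by (intro ind) simp
  then show False by simp
qed

theorem theorem4p2:
  fixes f :: "complex \<Rightarrow> complex" and p q :: nat
    and U :: "complex set" and I\<^sub>1 I\<^sub>2 :: "complex \<Rightarrow> real"
  assumes f_analytic: "real_analytic_at f 0"
    and elliptic: "elliptic_fixed_point f (real p / real q)"
    and normalised: "linear_part f = (\<lambda>z. cis (2 * pi * (real p / real q)) * z)"
    and rot: "coprime p q" "q \<ge> 3"
    and U: "open U" "0 \<in> U"
    and I1: "analytic_first_integral f U I\<^sub>1"
    and I1_min: "nondegenerate_local_min I\<^sub>1 0"
    and I2: "analytic_first_integral f U I\<^sub>2"
    and indep: "\<exists>V. open V \<and> V \<subseteq> U \<and> U \<subseteq> closure V \<and> functionally_independent_on I\<^sub>1 I\<^sub>2 V"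
  shows "analytically_conjugate f (linear_part f)"
proof -
  define \<omega> where "\<omega> = real p / real q"
  define \<mu> where "\<mu> = cis (2 * pi * \<omega>)"
  have \<omega>: "0 < \<omega>" "\<omega> < 1 / 2" and f0: "f 0 = 0" and "f differentiable at 0"
    using elliptic unfolding elliptic_fixed_point_def \<omega>_def by auto
  then have f_der: "(f has_derivative (\<lambda>h. \<mu> * h)) (at 0)"
    using frechet_derivative_works[of f "at 0"] normalised by (simp add: linear_part_def \<mu>_def \<omega>_def)
  have q: "0 < q" using rot(2) by simp
  have \<mu>_norm: "norm \<mu> = 1" by (simp add: \<mu>_def)
  \<comment> \<open>The bound \<omega> < 1/2 puts the angle strictly between 0 and pi, so \<mu> is
    not real.\<close>
  have "0 < sin (2 * pi * \<omega>)" by (rule sin_gt_zero) (use \<omega> in auto)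
  then have \<mu>_Im: "Im \<mu> \<noteq> 0" by (simp add: \<mu>_def)
  have \<omega>q: "real q * (2 * pi * \<omega>) = 2 * pi * real p" using q by (simp add: \<omega>_def)
  have \<mu>_q: "\<mu> ^ q = 1"
    unfolding \<mu>_def using Complex.DeMoivre[of "2 * pi * \<omega>" q] cis_multiple_2pi[of "real p"] \<omega>q by simp
  have \<mu>0: "\<mu> \<noteq> 0" using \<mu>_norm by auto

  \<comment> \<open>Subtracting \<open>I\<^sub>1 0\<close> lets K have order 2; the constant term of
    \<open>I\<^sub>2\<close> is left to the approximating polynomials.\<close>
  define K where "K z = complex_of_real (I\<^sub>1 z - I\<^sub>1 0)" for z
  define L where "L z = complex_of_real (I\<^sub>2 z)" for z
  have I_an: "real_analytic_at I\<^sub>1 0" "real_analytic_at I\<^sub>2 0"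
    using I1 I2 U(2) unfolding analytic_first_integral_def real_analytic_on_def by auto
  have L_an: "real_analytic_at L 0" unfolding L_def[abs_def] by (rule real_analytic_of_real[OF I_an(2)])
  have K_an: "real_analytic_at K 0"
    using real_analytic_diff[OF real_analytic_of_real[OF I_an(1)] real_analytic_const[of "of_real (I\<^sub>1 0)"]]
    by (simp add: K_def[abs_def])
  have K_inv: "\<forall>\<^sub>F z in nhds 0. K (f z) = K z" and L_inv: "\<forall>\<^sub>F z in nhds 0. L (f z) = L z"
    using I1 I2 unfolding analytic_first_integral_def K_def L_def by (auto elim: eventually_mono)

  have "(I\<^sub>1 has_derivative (\<lambda>_. 0)) (at 0)" using I1_min unfolding nondegenerate_local_min_def by blast
  then have "(K has_derivative (\<lambda>_. 0)) (at 0)"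
    unfolding K_def[abs_def] by (auto intro!: derivative_eq_intros)
  then have K2: "order_ge 2 K"
    by (intro has_derivative_0_imp_order_ge_2 K_an) (simp_all add: K_def)
  have f2: "order_ge 2 (\<lambda>z. f z - \<mu> * z)"
    by (intro has_derivative_0_imp_order_ge_2 real_analytic_diff real_analytic_mult real_analytic_const
        real_analytic_ident f_analytic) (use f0 f_der in \<open>auto intro!: derivative_eq_intros\<close>)
  obtain c where c: "order_ge 3 (\<lambda>z. K z - c * of_real ((norm z)\<^sup>2))"
    "order_ge 3 (\<lambda>z. K z - hpoly 2 (\<lambda>i. if i = 1 then 0 else c) z)"
    by (rule invariant_quadratic_part[OF K_an K2 f2 K_inv \<mu>_norm \<mu>_Im]) (rule that)
  have "c \<noteq> 0"
  proof
    assume "c = 0"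
    then have "hessian I\<^sub>1 0 1 1 = 0"
      using hessian_eq_0_of_order_ge_3[of I\<^sub>1] K_an c(1) unfolding K_def[abs_def] by simp
    moreover have "hessian I\<^sub>1 0 1 1 > 0"
      using I1_min unfolding nondegenerate_local_min_def by simp
    ultimately show False by simp
  qed

  define h where "h z = (f ^^ q) z - z" for z
  have fq_der: "((f ^^ q) has_derivative (\<lambda>h. h)) (at 0)"
    using funpow_has_derivative[OF f_der f0, of q] \<mu>_q by simp
  have h_an: "real_analytic_at h 0"
    unfolding h_def[abs_def] by (intro real_analytic_diff real_analytic_funpow f_analytic f0 real_analytic_ident)
  have h2: "order_ge 2 h"
    by (intro has_derivative_0_imp_order_ge_2 h_an)
       (use real_analytic_funpow(2)[OF f_analytic f0] has_derivative_diff[OF fq_der has_derivative_ident]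
         in \<open>simp_all add: h_def[abs_def]\<close>)
  have fq: "\<forall>\<^sub>F z in nhds 0. h z = 0"
  proof (rule ccontr)
    assume h_nz: "\<not> (\<forall>\<^sub>F z in nhds 0. h z = 0)"
    have "\<forall>\<^sub>F z in nhds 0. K (z + h z) = K z" "\<forall>\<^sub>F z in nhds 0. L (z + h z) = L z"
      using funpow_first_integral[OF f_analytic f0 K_inv, of q] funpow_first_integral[OF f_analytic f0 L_inv, of q]
      by (simp_all add: h_def)
    note formal = first_integral_formal_function[OF h_an h2 h_nz K_an K2 this(1) \<open>c \<noteq> 0\<close> c L_an this(2)]
    obtain kx ky lx ly where J:
      "\<forall>\<^sub>F z in nhds 0. (K has_derivative (\<lambda>h. kx z * of_real (Re h) + ky z * of_real (Im h))) (at z)"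
      "\<forall>\<^sub>F z in nhds 0. (L has_derivative (\<lambda>h. lx z * of_real (Re h) + ly z * of_real (Im h))) (at z)"
      "\<forall>\<^sub>F z in nhds 0. kx z * ly z - ky z * lx z = 0"
      by (rule jacobian_eq_0_of_formal_function[OF K_an L_an formal]) (rule that)
    have "\<forall>\<^sub>F z in nhds 0. (K has_derivative (\<lambda>h. kx z * of_real (Re h) + ky z * of_real (Im h))) (at z)
        \<and> (L has_derivative (\<lambda>h. lx z * of_real (Re h) + ly z * of_real (Im h))) (at z)
        \<and> kx z * ly z - ky z * lx z = 0"
      by (intro eventually_conj J)
    then obtain W where W: "open W" "0 \<in> W" and W': "\<And>z. z \<in> W \<Longrightarrow>
        (K has_derivative (\<lambda>h. kx z * of_real (Re h) + ky z * of_real (Im h))) (at z)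
        \<and> (L has_derivative (\<lambda>h. lx z * of_real (Re h) + ly z * of_real (Im h))) (at z)
        \<and> kx z * ly z - ky z * lx z = 0"
      unfolding eventually_nhds by blast
    obtain V where V: "U \<subseteq> closure V" "functionally_independent_on I\<^sub>1 I\<^sub>2 V" using indep by blast
    \<comment> \<open>The point 0 is not in V, as the differential of \<open>I\<^sub>1\<close>
      vanishes there, but it lies in the closure of V, so its neighbourhood W meets V.\<close>
    have "W \<inter> V \<noteq> {}" using V(1) U(2) W open_Int_closure_eq_empty[OF W(1), of V] by blast
    then obtain z where z: "z \<in> W" "z \<in> V" by blast
    from W'[OF z(1)] show False
      unfolding K_def[abs_def] L_def[abs_def]
      by (elim conjE) (rule functionally_dependent_at[OF _ _ _ V(2) z(2)])
  qed

  \<comment> \<open>The average over the finite cyclic group of germs generated by f, twisted by the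
    character \<mu> ^ j, projects the identity onto the maps that composition with f multiplies by
    \<mu>.\<close>
  define \<psi> where "\<psi> z = (\<Sum>j<q. (f ^^ j) z / \<mu> ^ j) / of_nat q" for z
  have \<psi>_an: "real_analytic_at \<psi> 0"
    unfolding \<psi>_def[abs_def] divide_inverse
    by (intro real_analytic_mult real_analytic_sum real_analytic_const real_analytic_funpow f_analytic f0)
  have \<psi>0: "\<psi> 0 = 0" using real_analytic_funpow(2)[OF f_analytic f0] by (simp add: \<psi>_def)
  \<comment> \<open>Each of the q summands is tangent to the identity, since the powers of \<mu>
    cancel, and so is their mean.\<close>
  have "(\<psi> has_derivative (\<lambda>h. (\<Sum>j<q. \<mu> ^ j * h * inverse (\<mu> ^ j)) * inverse (of_nat q))) (at 0)"
    unfolding \<psi>_def[abs_def] divide_inverse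
    by (intro has_derivative_mult_left has_derivative_sum conjunct1[OF funpow_has_derivative[OF f_der f0]])
  moreover have "(\<lambda>h. (\<Sum>j<q. \<mu> ^ j * h * inverse (\<mu> ^ j)) * inverse (of_nat q)) = (\<lambda>h. h)"
    using \<mu>0 q by (simp add: fun_eq_iff field_simps)
  ultimately have "(\<psi> has_derivative (\<lambda>h. h)) (at 0)" by simp
  then obtain \<phi> where \<phi>: "analytic_diffeo_germ \<phi> \<psi>"
    by (rule real_analytic_inverse[OF \<psi>_an \<psi>0]) (rule that)
  have \<psi>f: "\<forall>\<^sub>F z in nhds 0. \<psi> (f z) = \<mu> * \<psi> z"
    using fq
  proof eventually_elim
    case (elim z)
    let ?a = "\<lambda>j. (f ^^ j) z / \<mu> ^ j"
    have "(\<Sum>j<q. (f ^^ j) (f z) / \<mu> ^ j) = \<mu> * (\<Sum>j<q. ?a (Suc j))"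
      using \<mu>0 by (simp add: sum_distrib_left funpow_swap1)
    \<comment> \<open>The shift is cyclic: the terms with indices q and 0 coincide, as
      \<open>(f ^^ q) z = z\<close> and \<mu> ^ q = 1.\<close>
    moreover have "(\<Sum>j<q. ?a (Suc j)) = (\<Sum>j<q. ?a j)"
    proof -
      have "?a 0 + (\<Sum>j<q. ?a (Suc j)) = (\<Sum>j<q. ?a j) + ?a q"
        using sum.lessThan_Suc_shift[of ?a q] sum.lessThan_Suc[of ?a q] by simp
      moreover have "?a q = ?a 0" using elim \<mu>_q by (simp add: h_def)
      ultimately show ?thesis by simp
    qed
    ultimately show ?case by (simp add: \<psi>_def)
  qed
  have \<phi>': "real_analytic_at \<phi> 0" "\<phi> 0 = 0" "\<forall>\<^sub>F z in nhds 0. \<psi> (\<phi> z) = z"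
    using \<phi> unfolding analytic_diffeo_germ_def by auto
  have "\<forall>\<^sub>F z in nhds 0. \<psi> (f (\<phi> z)) = linear_part f z"
    using real_analytic_eventually_compose[OF \<phi>'(1,2) \<psi>f] \<phi>'(3)
    by eventually_elim (simp add: normalised \<mu>_def \<omega>_def)
  then show ?thesis using \<phi> unfolding analytically_conjugate_def by blast
qed

end
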